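(* Let $O$ be the unit-edge regular truncated octahedron, let $U$ be uniformly distributed on $S^2$ and let $W_O=w_O(U)$. Put $$\vartheta=\arccos\left(-\frac23\right),\qquad\beta(t)=\arccos\frac{t}{3\sqrt{10-t^2}}\quad(\sqrt6\le t\le3).$$ Then $W_O$ is supported on $[\sqrt6,\sqrt{10}]$ and has density $$f_O(t)=\begin{cases}0,& t<\sqrt6,\\ \dfrac{12}{\pi\sqrt{10}}\left(\vartheta-2\beta(t)\right),&\sqrt6\le t<2\sqrt2,\\ \dfrac{12}{\pi\sqrt{10}}\left(\pi-3\beta(t)\right),&2\sqrt2\le t<3,\\ \dfrac{12}{\sqrt{10}},&3\le t<\sqrt{10},\\ 0,& t\ge\sqrt{10}.\end{cases}$$
   Context: Concretely, $O=\sum_{j=1}^6\left[-\frac{r_j}2,\frac{r_j}2\right]$ (Minkowski sum of segments) with $r_1=\frac{(1,1,0)}{\sqrt2}$, $r_2=\frac{(1,-1,0)}{\sqrt2}$, $r_3=\frac{(1,0,1)}{\sqrt2}$, $r_4=\frac{(1,0,-1)}{\sqrt2}$, $r_5=\frac{(0,1,1)}{\sqrt2}$, $r_6=\frac{(0,1,-1)}{\sqrt2}$; its vertices are the twenty-four signed permutations of $(\sqrt2,1/\sqrt2,0)$. For a compact convex body $K$ and $u\in S^2$, $w_K(u)=\max_{x\in K}u\cdot x-\min_{x\in K}u\cdot x$. $U$ follows the rotation-invariant probability measure on $S^2$. *)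

theory Defs
  imports "HOL-Probability.Probability" "HOL-Library.Set_Algebras"
begin

definition trunc_oct_edges :: "(real^3) list" where
  "trunc_oct_edges = map (\<lambda>v. (1 / sqrt 2) *\<^sub>R v)
     [vector [1, 1, 0], vector [1, -1, 0], vector [1, 0, 1],
      vector [1, 0, -1], vector [0, 1, 1], vector [0, 1, -1]]"

text \<open>The sum is the Minkowski sum of sets provided by \<^theory>\<open>HOL-Library.Set_Algebras\<close>.\<close>

definition truncated_octahedron :: "(real^3) set" where
  "truncated_octahedron =
     (\<Sum>r\<leftarrow>trunc_oct_edges. closed_segment (- (1/2) *\<^sub>R r) ((1/2) *\<^sub>R r))"

text \<open>Intended for nonempty compact \<open>K\<close>, where supremum and infimum are attained and hence
  are the maximum and the minimum.\<close>

definition width :: "'a::euclidean_space set \<Rightarrow> 'a \<Rightarrow> real" where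
  "width K u = (SUP x\<in>K. u \<bullet> x) - (INF x\<in>K. u \<bullet> x)"

abbreviation sphere_borel :: "(real^3) measure" where
  "sphere_borel \<equiv> restrict_space borel (sphere 0 1)"

definition uniform_on_sphere :: "(real^3) measure \<Rightarrow> bool" where
  "uniform_on_sphere \<nu> \<longleftrightarrow>
     prob_space \<nu> \<and> sets \<nu> = sets sphere_borel \<and>
     (\<forall>Q. rotation_matrix Q \<longrightarrow> distr \<nu> \<nu> ((*v) Q) = \<nu>)"

text \<open>Such a measure exists: project the uniform distribution on the unit ball radially.\<close>

lemma emeasure_lborel_rotation_vimage:
  fixes Q :: "real^3^3"
  assumes "rotation_matrix Q" and A: "A \<in> sets borel"
  shows "emeasure lborel ((*v) Q -` A \<inter> ball 0 1) = emeasure lborel (A \<inter> ball 0 1)"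
proof -
  let ?P = "transpose Q"
  have oQ: "orthogonal_matrix Q" using assms by (simp add: rotation_matrix_def)
  have QP: "Q ** ?P = mat 1" "?P ** Q = mat 1"
    using oQ by (auto simp: orthogonal_matrix_def)
  have oP: "orthogonal_transformation ((*v) ?P)"
    using oQ by (simp add: orthogonal_transformation_matrix orthogonal_matrix_transpose
        matrix_of_matrix_vector_mul)
  have oT: "orthogonal_transformation ((*v) Q)"
    using oQ by (simp add: orthogonal_transformation_matrix matrix_of_matrix_vector_mul)
  have inv: "Q *v (?P *v x) = x" "?P *v (Q *v x) = x" for x
    using QP by (simp_all add: matrix_vector_mul_assoc del: transpose_matrix_vector)
  have img: "(*v) Q -` A \<inter> ball 0 1 = (*v) ?P ` (A \<inter> ball 0 1)"
  proof -
    have n: "norm (Q *v x) = norm x" "norm (?P *v x) = norm x" for x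
      using oT oP by (auto simp: orthogonal_transformation)
    show ?thesis
    proof (intro equalityI subsetI)
      fix x assume "x \<in> (*v) Q -` A \<inter> ball 0 1"
      then have "Q *v x \<in> A \<inter> ball 0 1" "x = ?P *v (Q *v x)" by (auto simp: n inv simp del: transpose_matrix_vector)
      then show "x \<in> (*v) ?P ` (A \<inter> ball 0 1)" by blast
    qed (auto simp: n inv simp del: transpose_matrix_vector)
  qed
  have fm: "emeasure lebesgue (A \<inter> ball 0 1) < \<infinity>"
  proof -
    have "emeasure lborel (A \<inter> ball 0 1) \<le> emeasure lborel (ball 0 1 :: (real^3) set)"
      using A by (intro emeasure_mono) auto
    also have "\<dots> < \<infinity>" by (rule emeasure_lborel_ball_finite)
    finally show ?thesis using A by simp
  qed
  have lm: "A \<inter> ball 0 1 \<in> lmeasurable"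
    using A fm by (auto simp: fmeasurable_def)
  have m1: "(*v) ?P ` (A \<inter> ball 0 1) \<in> lmeasurable"
    and m2: "measure lebesgue ((*v) ?P ` (A \<inter> ball 0 1)) = measure lebesgue (A \<inter> ball 0 1)"
    using measurable_orthogonal_image[OF oP lm] measure_orthogonal_image[OF oP lm] by auto
  have "emeasure lebesgue ((*v) ?P ` (A \<inter> ball 0 1)) = emeasure lebesgue (A \<inter> ball 0 1)"
    using m1 lm m2 by (simp add: emeasure_eq_measure2)
  moreover have "(*v) Q -` A \<inter> ball 0 1 \<in> sets borel"
  proof -
    have "(*v) Q \<in> borel_measurable borel"
      by (intro borel_measurable_continuous_onI matrix_vector_mult_linear_continuous_on)
    then have "(*v) Q -` A \<in> sets borel" using measurable_sets_borel A by blast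
    then show ?thesis by auto
  qed
  ultimately show ?thesis using A img by simp
qed

lemma uniform_on_sphere_exists: "\<exists>\<nu>. uniform_on_sphere \<nu>"
proof -
  define e :: "real^3" where "e = axis 1 1"
  define B where "B = uniform_measure lborel (ball (0::real^3) 1)"
  define p :: "real^3 \<Rightarrow> real^3" where "p = (\<lambda>x. if x = 0 then e else x /\<^sub>R norm x)"
  have pos: "emeasure lborel (ball (0::real^3) 1) \<noteq> 0"
  proof
    assume "emeasure lborel (ball (0::real^3) 1) = 0"
    then have "ball (0::real^3) 1 \<in> null_sets lborel" by auto
    then have "interior (ball (0::real^3) 1) = {}"
      using open_not_negligible[of "ball (0::real^3) 1"]
      by (metis completion.complete2 null_sets_completionI negligible_iff_null_sets open_ball
          interior_empty)
    then show False by (simp add: interior_open)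
  qed
  interpret B: prob_space B
    unfolding B_def
    by (metis prob_space_uniform_measure pos emeasure_lborel_ball_finite less_top infinity_ennreal_def)
  have sB: "sets B = sets borel" "space B = UNIV" by (auto simp: B_def)
  have pm: "p \<in> B \<rightarrow>\<^sub>M sphere_borel"
  proof (rule measurable_restrict_space2)
    show "p \<in> space B \<rightarrow> sphere 0 1" by (auto simp: p_def e_def)
    show "p \<in> borel_measurable B"
      unfolding measurable_cong_sets[OF sB(1) refl] p_def by measurable
  qed
  let ?\<nu> = "distr B sphere_borel p"
  have "distr ?\<nu> ?\<nu> ((*v) Q) = ?\<nu>" if Q: "rotation_matrix Q" for Q
  proof -
    have oT: "orthogonal_transformation ((*v) Q)"
      using Q by (simp add: rotation_matrix_def orthogonal_transformation_matrix
          matrix_of_matrix_vector_mul)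
    have n: "norm (Q *v x) = norm x" for x
      using oT by (auto simp: orthogonal_transformation)
    have Qb: "(*v) Q \<in> borel_measurable borel"
      by (intro borel_measurable_continuous_onI matrix_vector_mult_linear_continuous_on)
    have Qm: "(*v) Q \<in> sphere_borel \<rightarrow>\<^sub>M sphere_borel"
      using Qb by (intro measurable_restrict_space3) (auto simp: n)
    have BQ: "distr B B ((*v) Q) = B"
    proof (rule measure_eqI)
      fix A assume "A \<in> sets (distr B B ((*v) Q))"
      then have A: "A \<in> sets borel" by (simp add: sB)
      have "(*v) Q -` A \<in> sets borel" using measurable_sets_borel Qb A by blast
      moreover have "(*v) Q \<in> B \<rightarrow>\<^sub>M B" using Qb sB measurable_cong_sets by blast
      ultimately show "emeasure (distr B B ((*v) Q)) A = emeasure B A"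
        using A emeasure_lborel_rotation_vimage[OF Q A]
        by (simp add: emeasure_distr sB) (simp add: B_def Int_commute)
    qed (simp add: sB)
    have e0: "AE x in B. x \<noteq> 0"
      unfolding B_def using AE_lborel_singleton[of "0::real^3"]
      by (intro AE_uniform_measureI) auto
    have QB: "(*v) Q \<in> B \<rightarrow>\<^sub>M B" using Qb sB measurable_cong_sets by blast
    have "distr ?\<nu> ?\<nu> ((*v) Q) = distr ?\<nu> sphere_borel ((*v) Q)"
      by (rule distr_cong) auto
    also have "\<dots> = distr B sphere_borel ((*v) Q \<circ> p)"
      using Qm pm by (simp add: distr_distr)
    also have "\<dots> = distr B sphere_borel (p \<circ> (*v) Q)"
    proof (rule distr_cong_AE)
      show "AE x in B. ((*v) Q \<circ> p) x = (p \<circ> (*v) Q) x"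
        using e0
      proof eventually_elim
        case (elim x)
        then have "Q *v x \<noteq> 0" using n[of x] by auto
        then show ?case using elim by (simp add: p_def n matrix_vector_mult_scaleR)
      qed
    qed (use Qm pm QB in \<open>auto intro: measurable_comp\<close>)
    also have "\<dots> = distr (distr B B ((*v) Q)) sphere_borel p"
      using pm QB by (simp add: distr_distr)
    also have "\<dots> = ?\<nu>" by (simp add: BQ)
    finally show ?thesis .
  qed
  then have "uniform_on_sphere ?\<nu>"
    unfolding uniform_on_sphere_def using B.prob_space_distr[OF pm] by simp
  then show ?thesis by blast
qed

definition topological_support :: "'a::topological_space measure \<Rightarrow> 'a set" where
  "topological_support \<mu> = {x. \<forall>V. open V \<longrightarrow> x \<in> V \<longrightarrow> emeasure \<mu> V > 0}"

definition width_theta :: real where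
  "width_theta = arccos (- 2 / 3)"

definition width_beta :: "real \<Rightarrow> real" where
  "width_beta t = arccos (t / (3 * sqrt (10 - t\<^sup>2)))"

definition trunc_oct_width_density :: "real \<Rightarrow> real" where
  "trunc_oct_width_density t =
     (if t < sqrt 6 then 0
      else if t < 2 * sqrt 2 then 12 / (pi * sqrt 10) * (width_theta - 2 * width_beta t)
      else if t < 3 then 12 / (pi * sqrt 10) * (pi - 3 * width_beta t)
      else if t < sqrt 10 then 12 / sqrt 10
      else 0)"

end

theory Submission
  imports Defs
begin

text \<open>The width is \<open>w(u) = \<Sum> \<bar>u \<bullet> r\<^sub>j\<bar>\<close>. On the cone \<open>C\<close> given by \<open>u\<^sub>1 > u\<^sub>2 > \<bar>u\<^sub>3\<bar>\<close> it equals
  \<open>sqrt 10 * (u \<bullet> n)\<close> with \<open>n = (2, 1, 0) / sqrt 5\<close>, and the \<open>24\<close> rotations of the cube move \<open>C\<close> over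
  almost all of the sphere. By rotation invariance \<open>u \<bullet> n\<close> is uniform on \<open>[-1, 1]\<close> (Archimedes), and
  averaging over the rotations about \<open>n\<close> shows that the density at \<open>t\<close> is \<open>12 / sqrt 10\<close> times the
  fraction of the circle \<open>u \<bullet> n = t / sqrt 10\<close> that lies in \<open>C\<close>. Each of the three walls of \<open>C\<close> cuts
  off an arc of half-width \<open>\<beta>(t)\<close>. The centres of two of these arcs have distance \<open>\<vartheta>\<close> from the third
  one, so the three are disjoint for \<open>t \<ge> 2 * sqrt 2\<close> and two of them overlap below.\<close>

subsection \<open>The width function\<close>

text \<open>A linear functional on a Minkowski sum splits into its values on the summands, and on
  the segment of \<open>r\<close> it ranges over [-|u . r| / 2, |u . r| / 2]. Attainment is carried
  along so that supremum and infimum become maximum and minimum.\<close>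

lemma sum_segments_support:
  fixes rs :: "'a::euclidean_space list" and u :: 'a
  defines "K \<equiv> (\<Sum>r\<leftarrow>rs. closed_segment (- (1/2) *\<^sub>R r) ((1/2) *\<^sub>R r))"
    and "h \<equiv> (\<Sum>r\<leftarrow>rs. \<bar>u \<bullet> r\<bar>) / 2"
  shows "(\<forall>x\<in>K. \<bar>u \<bullet> x\<bar> \<le> h) \<and> (\<exists>x\<in>K. u \<bullet> x = h) \<and> (\<exists>x\<in>K. u \<bullet> x = - h)"
  unfolding K_def h_def
proof (induction rs)
  case (Cons r rs)
  let ?S = "closed_segment (- (1/2) *\<^sub>R r) ((1/2) *\<^sub>R r)"
  have seg: "\<bar>u \<bullet> x\<bar> \<le> \<bar>u \<bullet> r\<bar> / 2" if x: "x \<in> ?S" for x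
  proof -
    from x obtain t where t: "0 \<le> t" "t \<le> 1" "x = (1 - t) *\<^sub>R (- (1/2) *\<^sub>R r) + t *\<^sub>R ((1/2) *\<^sub>R r)"
      by (auto simp: closed_segment_def)
    have "u \<bullet> x = (t - 1/2) * (u \<bullet> r)"
      unfolding t(3) by (simp add: inner_add_right inner_diff_right field_simps)
    moreover have "\<bar>t - 1/2\<bar> \<le> 1/2" using t by linarith
    ultimately show ?thesis
      using mult_right_mono[of "\<bar>t - 1/2\<bar>" "1/2" "\<bar>u \<bullet> r\<bar>"] by (simp add: abs_mult)
  qed
  have ends: "- (1/2) *\<^sub>R r \<in> ?S" "(1/2) *\<^sub>R r \<in> ?S" by auto
  have ex: "\<exists>x\<in>?S. u \<bullet> x = \<bar>u \<bullet> r\<bar> / 2" "\<exists>x\<in>?S. u \<bullet> x = - (\<bar>u \<bullet> r\<bar> / 2)"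
    using ends by (cases "u \<bullet> r \<ge> 0"; force)+
  show ?case
  proof (intro conjI ballI)
    fix x assume "x \<in> (\<Sum>r\<leftarrow>r # rs. closed_segment (- (1/2) *\<^sub>R r) ((1/2) *\<^sub>R r))"
    then obtain a b where ab: "a \<in> ?S" "b \<in> (\<Sum>r\<leftarrow>rs. closed_segment (- (1/2) *\<^sub>R r) ((1/2) *\<^sub>R r))" "x = a + b"
      by (auto elim!: set_plus_elim)
    show "\<bar>u \<bullet> x\<bar> \<le> (\<Sum>r\<leftarrow>r # rs. \<bar>u \<bullet> r\<bar>) / 2"
      using seg[OF ab(1)] Cons.IH ab(2) unfolding ab(3) inner_add_right
      by (fastforce simp: add_divide_distrib intro: order_trans[OF abs_triangle_ineq])
  next
    obtain a b where "a \<in> ?S" "u \<bullet> a = \<bar>u \<bullet> r\<bar> / 2"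
      "b \<in> (\<Sum>r\<leftarrow>rs. closed_segment (- (1/2) *\<^sub>R r) ((1/2) *\<^sub>R r))" "u \<bullet> b = (\<Sum>r\<leftarrow>rs. \<bar>u \<bullet> r\<bar>) / 2"
      using ex(1) Cons.IH by blast
    then show "\<exists>x\<in>\<Sum>r\<leftarrow>r # rs. closed_segment (- (1/2) *\<^sub>R r) ((1/2) *\<^sub>R r). u \<bullet> x = (\<Sum>r\<leftarrow>r # rs. \<bar>u \<bullet> r\<bar>) / 2"
      by (intro bexI[of _ "a + b"]) (auto simp: inner_add_right add_divide_distrib)
  next
    obtain a b where "a \<in> ?S" "u \<bullet> a = - (\<bar>u \<bullet> r\<bar> / 2)"
      "b \<in> (\<Sum>r\<leftarrow>rs. closed_segment (- (1/2) *\<^sub>R r) ((1/2) *\<^sub>R r))" "u \<bullet> b = - ((\<Sum>r\<leftarrow>rs. \<bar>u \<bullet> r\<bar>) / 2)"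
      using ex(2) Cons.IH by blast
    then show "\<exists>x\<in>\<Sum>r\<leftarrow>r # rs. closed_segment (- (1/2) *\<^sub>R r) ((1/2) *\<^sub>R r). u \<bullet> x = - ((\<Sum>r\<leftarrow>r # rs. \<bar>u \<bullet> r\<bar>) / 2)"
      by (intro bexI[of _ "a + b"]) (auto simp: inner_add_right add_divide_distrib)
  qed
qed auto

lemma width_sum_segments:
  fixes rs :: "'a::euclidean_space list"
  shows "width (\<Sum>r\<leftarrow>rs. closed_segment (- (1/2) *\<^sub>R r) ((1/2) *\<^sub>R r)) u = (\<Sum>r\<leftarrow>rs. \<bar>u \<bullet> r\<bar>)"
proof -
  let ?K = "\<Sum>r\<leftarrow>rs. closed_segment (- (1/2) *\<^sub>R r) ((1/2) *\<^sub>R r)"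
  let ?h = "(\<Sum>r\<leftarrow>rs. \<bar>u \<bullet> r\<bar>) / 2"
  note * = sum_segments_support[of rs u]
  have "(SUP x\<in>?K. u \<bullet> x) = ?h"
    by (rule cSup_eq_maximum) (use * in \<open>force\<close>)+
  moreover have "(INF x\<in>?K. u \<bullet> x) = - ?h"
    by (rule cInf_eq_minimum) (use * in \<open>force\<close>)+
  ultimately show ?thesis by (simp add: width_def)
qed

text \<open>Closed form of the width, used from here on: each absolute value is
  \<open>sqrt 2\<close> times |u . r| for one edge \<open>r\<close>.\<close>

definition oct_width :: "real^3 \<Rightarrow> real" where
  "oct_width u = (\<bar>u$1 + u$2\<bar> + \<bar>u$1 - u$2\<bar> + \<bar>u$1 + u$3\<bar> + \<bar>u$1 - u$3\<bar> + \<bar>u$2 + u$3\<bar> + \<bar>u$2 - u$3\<bar>) / sqrt 2"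

lemma width_truncated_octahedron: "width truncated_octahedron u = oct_width u"
  unfolding truncated_octahedron_def width_sum_segments
  by (simp add: trunc_oct_edges_def oct_width_def inner_vec_def sum_3 abs_mult abs_divide add_divide_distrib flip: add_divide_distrib diff_divide_distrib)

text \<open>The chamber is the interior of the normal cone of the vertex (sqrt 2, 1 / sqrt 2, 0),
  and by central symmetry the width is twice the inner product with this vertex. Concretely, all six
  absolute values open with a plus sign.\<close>

lemma oct_width_chamber:
  assumes "u$1 > u$2" "u$2 > \<bar>u$3\<bar>"
  shows "oct_width u = sqrt 2 * (2 * u$1 + u$2)"
proof -
  have "\<bar>u$1 + u$2\<bar> = u$1 + u$2" "\<bar>u$1 - u$2\<bar> = u$1 - u$2" "\<bar>u$1 + u$3\<bar> = u$1 + u$3"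
    "\<bar>u$1 - u$3\<bar> = u$1 - u$3" "\<bar>u$2 + u$3\<bar> = u$2 + u$3" "\<bar>u$2 - u$3\<bar> = u$2 - u$3"
    using assms by linarith+
  then have "oct_width u = 2 * (2 * u$1 + u$2) / sqrt 2"
    unfolding oct_width_def by simp
  moreover have "2 / sqrt 2 = sqrt 2" by (rule real_div_sqrt) simp
  ultimately show ?thesis by (metis times_divide_eq_left)
qed

lemma measurable_oct_width [measurable]: "oct_width \<in> borel_measurable borel"
  unfolding oct_width_def by (intro borel_measurable_continuous_onI continuous_intros) simp

subsection \<open>Linear functionals of a uniform point on the sphere\<close>

lemma measurable_matrix_vector_mult: "(*v) (Q :: real^3^3) \<in> borel_measurable borel"
  by (intro borel_measurable_continuous_onI matrix_vector_mult_linear_continuous_on)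

text \<open>The law of the point is kept as a Borel measure on the whole space that is carried by
  the sphere, so that measurability concerns \<open>real^3\<close> rather than a restricted
  space.\<close>

locale rotation_invariant_sphere = prob_space N for N :: "(real^3) measure" +
  assumes sets_N [measurable_cong, simp]: "sets N = sets borel"
    and AE_norm: "AE u in N. norm u = 1"
    and distr_rotation: "rotation_matrix Q \<Longrightarrow> distr N borel ((*v) Q) = N"
begin

lemma space_N [simp]: "space N = UNIV"
  using sets_eq_imp_space_eq[OF sets_N] by simp

lemma measurable_inner_left [measurable]: "(\<lambda>u. u \<bullet> a) \<in> borel_measurable N"
  by (simp cong: measurable_cong_sets)

lemma nn_integral_rotation:
  assumes "rotation_matrix Q" and "f \<in> borel_measurable borel"
  shows "(\<integral>\<^sup>+ u. f (Q *v u) \<partial>N) = (\<integral>\<^sup>+ u. f u \<partial>N)"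
proof -
  have "(\<integral>\<^sup>+ u. f u \<partial>N) = (\<integral>\<^sup>+ u. f u \<partial>distr N borel ((*v) Q))"
    using assms(1) by (simp add: distr_rotation)
  also have "\<dots> = (\<integral>\<^sup>+ u. f (Q *v u) \<partial>N)"
    using assms(2) measurable_matrix_vector_mult[of Q] by (intro nn_integral_distr) (simp_all cong: measurable_cong_sets)
  finally show ?thesis ..
qed

text \<open>Some rotation takes \<open>b\<close> to \<open>a\<close>. The inner product of
  \<open>u\<close> with \<open>a\<close> is that of the transpose applied to \<open>u\<close> with
  \<open>b\<close>, and the transpose preserves the law.\<close>

lemma distr_inner_unit_eq:
  assumes "norm a = 1" and "norm b = 1"
  shows "distr N borel (\<lambda>u. u \<bullet> a) = distr N borel (\<lambda>u. u \<bullet> b)"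
proof -
  obtain f where f: "orthogonal_transformation f" "det (matrix f) = 1" "f b = a"
    using rotation_exists[of b a] assms by auto
  have lin: "linear f" using f(1) by (simp add: orthogonal_transformation)
  let ?Q = "transpose (matrix f)"
  have om: "orthogonal_matrix (matrix f)"
    using f(1) orthogonal_transformation_matrix by blast
  then have Q: "rotation_matrix ?Q"
    using f(2) by (simp add: rotation_matrix_def orthogonal_matrix_transpose)
  have eq: "u \<bullet> a = (?Q *v u) \<bullet> b" for u
  proof -
    have "(?Q *v u) \<bullet> b = u \<bullet> (matrix f *v b)"
      by (metis dot_lmul_matrix inner_commute transpose_matrix_vector)
    then show ?thesis using f(3) lin by (simp add: matrix_works)
  qed
  have "distr N borel (\<lambda>u. u \<bullet> a) = distr N borel ((\<lambda>u. u \<bullet> b) \<circ> (*v) ?Q)"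
    by (simp add: eq comp_def)
  also have "\<dots> = distr (distr N borel ((*v) ?Q)) borel (\<lambda>u. u \<bullet> b)"
    using measurable_matrix_vector_mult[of ?Q] by (intro distr_distr[symmetric]) (simp_all cong: measurable_cong_sets)
  finally show ?thesis by (simp only: distr_rotation[OF Q])
qed

lemma expectation_inner_unit_eq:
  fixes g :: "real \<Rightarrow> real"
  assumes "norm a = 1" "norm b = 1" and g: "g \<in> borel_measurable borel"
  shows "expectation (\<lambda>u. g (u \<bullet> a)) = expectation (\<lambda>u. g (u \<bullet> b))"
  using distr_inner_unit_eq[OF assms(1,2)]
    integral_distr[OF measurable_inner_left[of a] g] integral_distr[OF measurable_inner_left[of b] g]
  by simp

lemma AE_abs_inner_le: "norm a = 1 \<Longrightarrow> AE u in N. \<bar>u \<bullet> a\<bar> \<le> 1"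
  using AE_norm by eventually_elim (metis Cauchy_Schwarz_ineq2 mult_1)

lemma integrable_inner_powers:
  assumes "norm a = 1" "norm b = 1"
  shows "integrable N (\<lambda>u. (u \<bullet> a) ^ i * (u \<bullet> b) ^ j)"
proof (rule integrable_const_bound)
  show "AE u in N. norm ((u \<bullet> a) ^ i * (u \<bullet> b) ^ j) \<le> 1"
    using AE_abs_inner_le[OF assms(1)] AE_abs_inner_le[OF assms(2)]
    by eventually_elim (simp add: abs_mult power_abs power_le_one mult_le_one)
qed simp

definition moment :: "nat \<Rightarrow> real" where
  "moment m = expectation (\<lambda>u. (u \<bullet> axis 1 1) ^ m)"

lemma moment_eq: "norm a = 1 \<Longrightarrow> expectation (\<lambda>u. (u \<bullet> a) ^ m) = moment m"
  unfolding moment_def by (rule expectation_inner_unit_eq) auto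

lemma moment_0: "moment 0 = 1"
  using prob_space by (simp add: moment_def)

text \<open>The unit vector \<open>axis 1 1\<close> and its negative have the same moments.\<close>

lemma moment_odd: "odd m \<Longrightarrow> moment m = 0"
  using moment_eq[of "- axis 1 1" m] by (simp add: moment_def)

text \<open>For orthonormal \<open>a\<close>, \<open>b\<close> and \<open>m = 2 * k + 2\<close>, invariance makes
  \<open>E ((u \<bullet> a + x * (u \<bullet> b)) ^ m) = (1 + x\<^sup>2) ^ (k + 1) * moment m\<close> a polynomial identity in \<open>x\<close>; the
  coefficients of \<open>x\<^sup>2\<close> are compared.\<close>
lemma mixed_moment:
  assumes "norm a = 1" "norm b = 1" "a \<bullet> b = 0"
  shows "(2 * real k + 1) * expectation (\<lambda>u. (u \<bullet> a) ^ (2 * k) * (u \<bullet> b)\<^sup>2) = moment (2 * k + 2)"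
proof -
  define n where "n = 2 * Suc k"
  define e where "e j = expectation (\<lambda>u. (u \<bullet> a) ^ (n - j) * (u \<bullet> b) ^ j)" for j
  define p where "p = (\<Sum>j\<le>n. monom (real (n choose j) * e j) j)"
  define q where "q = smult (moment n) ([:1, 0, 1:] ^ Suc k)"
  have "poly p x = poly q x" for x
  proof -
    define r where "r = sqrt (1 + x\<^sup>2)"
    have r2: "r\<^sup>2 = 1 + x\<^sup>2" and r0: "r > 0"
      by (auto simp: r_def add_pos_nonneg)
    \<comment> \<open>The vector a + x b is written as r c with a unit vector \<open>c\<close>,
      because the moments are the same in every unit direction.\<close>
    define c where "c = (1 / r) *\<^sub>R (a + x *\<^sub>R b)"
    have "a \<bullet> a = 1" "b \<bullet> b = 1" using assms by (simp_all add: norm_eq_1)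
    then have "(norm (a + x *\<^sub>R b))\<^sup>2 = r\<^sup>2"
      using assms(3) unfolding r2 power2_norm_eq_inner
      by (simp add: inner_add_left inner_add_right inner_commute power2_eq_square)
    then have "norm (a + x *\<^sub>R b) = r" using r0 by (simp add: power2_eq_iff_nonneg)
    then have c1: "norm c = 1" using r0 by (simp add: c_def)
    have uc: "u \<bullet> b * x + u \<bullet> a = r * (u \<bullet> c)" for u
      using r0 by (simp add: c_def inner_add_right)
    have "poly p x = (\<Sum>j\<le>n. expectation (\<lambda>u. real (n choose j) * x ^ j * ((u \<bullet> a) ^ (n - j) * (u \<bullet> b) ^ j)))"
      by (simp add: p_def poly_sum poly_monom e_def mult_ac)
    also have "\<dots> = expectation (\<lambda>u. \<Sum>j\<le>n. real (n choose j) * x ^ j * ((u \<bullet> a) ^ (n - j) * (u \<bullet> b) ^ j))"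
      by (rule Bochner_Integration.integral_sum[symmetric])
        (intro integrable_mult_right integrable_inner_powers assms)
    also have "\<dots> = expectation (\<lambda>u. (u \<bullet> b * x + u \<bullet> a) ^ n)"
      by (simp add: binomial_ring power_mult_distrib mult_ac)
    also have "\<dots> = r ^ n * moment n"
      by (simp add: uc power_mult_distrib moment_eq[OF c1])
    also have "\<dots> = poly q x"
      unfolding q_def n_def power_mult r2 by (simp add: power2_eq_square algebra_simps)
    finally show ?thesis .
  qed
  then have "p = q" by (simp add: poly_eq_poly_eq_iff[symmetric] fun_eq_iff)
  then have "coeff p 2 = coeff q 2" by simp
  moreover have "2 \<le> n" by (simp add: n_def)
  moreover from this have "coeff p 2 = real (n choose 2) * e 2"
    by (simp add: p_def coeff_sum if_distrib[of "\<lambda>x. _ * x"] sum.delta cong: if_cong)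
  \<comment> \<open>The degree 2 coefficient of the next power also involves the one of degree 0,
    hence the joint induction.\<close>
  moreover have co: "coeff ([:1, 0, 1::real:] ^ m) 0 = 1 \<and> coeff ([:1, 0, 1::real:] ^ m) 1 = 0
      \<and> coeff ([:1, 0, 1::real:] ^ m) 2 = real m" for m
    by (induction m) (auto simp: coeff_mult numeral_2_eq_2)
  ultimately have "real (n choose 2) * e 2 = moment n * real (Suc k)"
    unfolding q_def using co[of "Suc k"] by (simp del: power_Suc)
  moreover have "real (n choose 2) = real (Suc k) * (2 * real k + 1)"
  proof -
    have "n choose 2 = Suc k * (2 * k + 1)" by (simp add: n_def choose_two)
    then show ?thesis by (metis (mono_tags) of_nat_Suc of_nat_add of_nat_mult of_nat_numeral of_nat_1)
  qed
  ultimately have "real (Suc k) * ((2 * real k + 1) * e 2) = real (Suc k) * moment n"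
    by (simp add: mult_ac)
  then have "(2 * real k + 1) * e 2 = moment n"
    by (metis mult_left_cancel of_nat_neq_0)
  then show ?thesis by (simp add: e_def n_def)
qed

text \<open>Inserting the factor 1 as the sum of the three squared coordinates turns the mixed
  moments into the recursion m(2k) = m(2k+2) (1 + 2 / (2k+1)). Its solution is the moment sequence
  of the uniform law on [-1, 1].\<close>

lemma moment_even: "moment (2 * k) = 1 / (2 * real k + 1)"
proof (induction k)
  case 0
  then show ?case by (simp add: moment_0)
next
  case (Suc k)
  let ?a = "axis 1 1 :: real^3" and ?b = "axis 2 1 :: real^3" and ?c = "axis 3 1 :: real^3"
  have o: "?a \<bullet> ?b = 0" "?a \<bullet> ?c = 0" by (simp_all add: inner_axis_axis)
  let ?E = "\<lambda>b::real^3. expectation (\<lambda>u. (u \<bullet> ?a) ^ (2 * k) * (u \<bullet> b)\<^sup>2)"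
  have int: "integrable N (\<lambda>u. (u \<bullet> ?a) ^ (2 * k) * (u \<bullet> b)\<^sup>2)" if "norm b = 1" for b
    using integrable_inner_powers[of ?a b] that by simp
  have "moment (2 * k) = expectation (\<lambda>u. (u \<bullet> ?a) ^ (2 * k) * (u \<bullet> ?a)\<^sup>2
      + (u \<bullet> ?a) ^ (2 * k) * (u \<bullet> ?b)\<^sup>2 + (u \<bullet> ?a) ^ (2 * k) * (u \<bullet> ?c)\<^sup>2)"
    unfolding moment_def
  proof (rule integral_cong_AE)
    show "AE u in N. (u \<bullet> ?a) ^ (2 * k) = (u \<bullet> ?a) ^ (2 * k) * (u \<bullet> ?a)\<^sup>2
      + (u \<bullet> ?a) ^ (2 * k) * (u \<bullet> ?b)\<^sup>2 + (u \<bullet> ?a) ^ (2 * k) * (u \<bullet> ?c)\<^sup>2"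
      using AE_norm
    proof eventually_elim
      case (elim u)
      then have "u \<bullet> u = 1" by (simp add: norm_eq_1)
      then have "(u \<bullet> ?a)\<^sup>2 + (u \<bullet> ?b)\<^sup>2 + (u \<bullet> ?c)\<^sup>2 = 1"
        by (simp add: inner_axis inner_vec_def[of u u] sum_3 power2_eq_square)
      then show ?case by (simp flip: distrib_left)
    qed
  qed simp_all
  also have "\<dots> = moment (2 * k + 2) + ?E ?b + ?E ?c"
    using int by (simp add: moment_def power_add power2_eq_square mult_ac)
  finally have *: "moment (2 * k) = moment (2 * k + 2) + ?E ?b + ?E ?c" .
  have "?E ?b = moment (2 * k + 2) / (2 * real k + 1)" "?E ?c = moment (2 * k + 2) / (2 * real k + 1)"
    using mixed_moment[of ?a ?b k] mixed_moment[of ?a ?c k] o by (auto simp: field_simps)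
  with * Suc have "1 / (2 * real k + 1) = moment (2 * k + 2) * (1 + 2 / (2 * real k + 1))"
    by (simp add: algebra_simps)
  then show ?case by (simp add: field_simps)
qed

text \<open>Both laws live on [-1, 1] and have the same moments. Hence their characteristic
  functions share all Taylor polynomials, with remainders that tend to 0, and Levy's uniqueness
  theorem applies.\<close>

lemma distr_inner_uniform:
  assumes a: "norm a = 1"
  shows "distr N borel (\<lambda>u. u \<bullet> a) = uniform_measure lborel {-1..1}"
proof -
  let ?D = "distr N borel (\<lambda>u. u \<bullet> a)"
  define L :: "real measure" where "L = distr (uniform_measure lborel {-1..1}) borel (\<lambda>x. x)"
  have L: "L = uniform_measure lborel {-1..1}"
    unfolding L_def by (rule measure_eqI) (auto simp: emeasure_distr)
  interpret D: real_distribution ?D by (rule real_distribution_distr) simp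
  have pL: "prob_space L"
    unfolding L by (rule prob_space_uniform_measure) auto
  interpret L: real_distribution L
    by (intro real_distribution.intro pL real_distribution_axioms.intro) (simp add: L)
  have AE_L: "AE x in L. \<bar>x\<bar> \<le> 1"
    unfolding L by (rule AE_uniform_measureI) auto
  have AE_D: "AE x in ?D. \<bar>x\<bar> \<le> 1"
    using AE_abs_inner_le[OF a] by (simp add: AE_distr_iff)
  have int_L: "integrable L (\<lambda>x. x ^ k)" for k
    using AE_L by (intro L.integrable_const_bound[of _ 1]) (auto elim!: eventually_mono simp: power_abs power_le_one)
  have int_D: "integrable ?D (\<lambda>x. x ^ k)" for k
    using AE_D by (intro D.integrable_const_bound[of _ 1]) (auto elim!: eventually_mono simp: power_abs power_le_one)
  have bd_L: "L.expectation (\<lambda>x. \<bar>x\<bar> ^ k) \<le> 1" for k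
    using AE_L integrable_abs[OF int_L[of k]] by (intro L.integral_le_const) (auto elim!: eventually_mono simp: power_le_one power_abs)
  have bd_D: "D.expectation (\<lambda>x. \<bar>x\<bar> ^ k) \<le> 1" for k
    using AE_D integrable_abs[OF int_D[of k]] by (intro D.integral_le_const) (auto elim!: eventually_mono simp: power_le_one power_abs)
  have mL: "L.expectation (\<lambda>x. x ^ k) = (if even k then 1 / (real k + 1) else 0)" for k
  proof -
    have "L = density lborel (\<lambda>x. ennreal (indicator {-1..1} x / 2))"
      unfolding L uniform_measure_def using divide_ennreal[of 1 2]
      by (intro density_cong) (auto split: split_indicator)
    then have "L.expectation (\<lambda>x. x ^ k) = (\<integral>x. indicator {-1..1} x * (x ^ k) / 2 \<partial>lborel)"
      by (simp add: integral_density)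
    also have "\<dots> = (1 ^ Suc k / real (2 * Suc k)) - ((-1) ^ Suc k / real (2 * Suc k))"
    proof -
      have der: "((\<lambda>x. x ^ Suc k / real (2 * Suc k)) has_real_derivative x ^ k / 2) (at x within S)" for x S
      proof -
        have eq: "real (Suc k) * x ^ k / real (2 * Suc k) = x ^ k / 2" by (simp add: field_simps)
        show ?thesis
          using DERIV_cdivide[OF DERIV_pow[of "Suc k" x S], of "real (2 * Suc k)"]
          by (simp only: One_nat_def[symmetric] diff_Suc_1 eq)
      qed
      have "(\<integral>x. indicator {-1..1::real} x *\<^sub>R (x ^ k / 2) \<partial>lborel) = (1 ^ Suc k / real (2 * Suc k)) - ((-1) ^ Suc k / real (2 * Suc k))"
      proof (rule integral_FTC_atLeastAtMost)
        show "((\<lambda>x. x ^ Suc k / real (2 * Suc k)) has_vector_derivative x ^ k / 2) (at x within {-1..1})" for x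
          using der by (simp only: has_real_derivative_iff_has_vector_derivative)
      qed (auto intro!: continuous_intros)
      then show ?thesis by simp
    qed
    also have "\<dots> = (if even k then 1 / (real k + 1) else 0)"
    proof -
      define c where "c = real k + 1"
      have "c > 0" "real (2 * Suc k) = 2 * c" by (simp_all add: c_def)
      then show ?thesis
        unfolding c_def[symmetric] \<open>real (2 * Suc k) = 2 * c\<close> by (auto simp: field_simps)
    qed
    finally show ?thesis .
  qed
  have mD: "D.expectation (\<lambda>x. x ^ k) = (if even k then 1 / (real k + 1) else 0)" for k
  proof -
    have "D.expectation (\<lambda>x. x ^ k) = moment k"
      by (simp add: integral_distr moment_eq[OF a])
    also have "\<dots> = (if even k then 1 / (real k + 1) else 0)"
      using moment_odd moment_even by (auto elim!: evenE)
    finally show ?thesis .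
  qed
  have "char ?D t = char L t" for t
  proof -
    have "cmod (char ?D t - char L t) \<le> 4 * (\<bar>t\<bar> ^ n / fact n)" for n
    proof -
      \<comment> \<open>The common Taylor polynomial. The remainder bound contains an absolute
        moment, which is at most 1 for both laws.\<close>
      let ?S = "\<Sum>k\<le>n. ((\<i> * t) ^ k / fact k) * complex_of_real (if even k then 1 / (real k + 1) else 0)"
      have "cmod (char ?D t - ?S) \<le> (2 * \<bar>t\<bar> ^ n / fact n) * D.expectation (\<lambda>x. \<bar>x\<bar> ^ n)"
        using D.char_approx1[of n t, OF int_D] unfolding mD .
      also have "\<dots> \<le> (2 * \<bar>t\<bar> ^ n / fact n) * 1"
        using bd_D by (intro mult_left_mono) auto
      finally have 1: "cmod (char ?D t - ?S) \<le> 2 * \<bar>t\<bar> ^ n / fact n" by simp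
      have "cmod (char L t - ?S) \<le> (2 * \<bar>t\<bar> ^ n / fact n) * L.expectation (\<lambda>x. \<bar>x\<bar> ^ n)"
        using L.char_approx1[of n t, OF int_L] unfolding mL .
      also have "\<dots> \<le> (2 * \<bar>t\<bar> ^ n / fact n) * 1"
        using bd_L by (intro mult_left_mono) auto
      finally have 2: "cmod (char L t - ?S) \<le> 2 * \<bar>t\<bar> ^ n / fact n" by simp
      show ?thesis
        using norm_triangle_ineq4[of "char ?D t - ?S" "char L t - ?S"] 1 2 by simp
    qed
    moreover have "(\<lambda>n. 4 * (\<bar>t\<bar> ^ n / fact n)) \<longlonglongrightarrow> 4 * 0"
      using summable_LIMSEQ_zero[OF summable_exp[of "\<bar>t\<bar>"]]
      by (intro tendsto_mult_left) (simp add: field_simps)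
    ultimately have "cmod (char ?D t - char L t) \<le> 0"
      by (intro LIMSEQ_le_const[where x = 0]) auto
    then show ?thesis by simp
  qed
  then have "?D = L"
    by (intro Levy_uniqueness) (auto simp: D.real_distribution_axioms L.real_distribution_axioms)
  then show ?thesis by (simp add: L)
qed

text \<open>The uniform law on [-1, 1] has no atoms.\<close>

lemma AE_inner_neq:
  assumes "norm a = 1"
  shows "AE u in N. u \<bullet> a \<noteq> c"
proof -
  have "AE x in distr N borel (\<lambda>u. u \<bullet> a). x \<noteq> c"
    unfolding distr_inner_uniform[OF assms]
    using AE_lborel_singleton[of c] by (intro AE_uniform_measureI) auto
  then show ?thesis by (subst (asm) AE_distr_iff) auto
qed

text \<open>Planes through the origin are null, in particular those that contain the walls of the
  chambers.\<close>

lemma AE_inner_neq_0: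
  assumes "a \<noteq> 0"
  shows "AE u in N. u \<bullet> a \<noteq> 0"
proof -
  have "AE u in N. u \<bullet> (a /\<^sub>R norm a) \<noteq> 0"
    using assms by (intro AE_inner_neq) simp
  then show ?thesis by eventually_elim auto
qed

end

subsection \<open>Reduction to one chamber\<close>

lemma matrix_vector_mult_3:
  "(A :: real^3^3) *v u = vector [A$1$1 * u$1 + A$1$2 * u$2 + A$1$3 * u$3,
     A$2$1 * u$1 + A$2$2 * u$2 + A$2$3 * u$3, A$3$1 * u$1 + A$3$2 * u$2 + A$3$3 * u$3]"
  by (simp add: vec_eq_iff forall_3 matrix_vector_mult_def sum_3)

lemma rotation_matrix_3I:
  fixes A :: "real^3^3"
  assumes "A$1 \<bullet> A$1 = 1" "A$2 \<bullet> A$2 = 1" "A$3 \<bullet> A$3 = 1"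
    and "A$1 \<bullet> A$2 = 0" "A$1 \<bullet> A$3 = 0" "A$2 \<bullet> A$3 = 0" and "det A = 1"
  shows "rotation_matrix A"
proof -
  have "A ** transpose A = mat 1"
    using assms(1-6) by (simp add: vec_eq_iff forall_3 matrix_matrix_mult_def sum_3 transpose_def
        mat_def inner_vec_def mult.commute)
  then show ?thesis
    using assms(7) matrix_left_right_inverse[of A "transpose A"]
    by (simp add: rotation_matrix_def orthogonal_matrix_def)
qed

text \<open>This and the next two are rotations of the cube of orders 3, 2 and 4, about a diagonal,
  the third axis and the first axis. Their powers are used one after the other, which gives 3 * 2 *
  4 = 24 without a list of the whole group.\<close>

definition cube_diagonal_rotation :: "real^3^3" where
  "cube_diagonal_rotation = vector [vector [0, 1, 0], vector [0, 0, 1], vector [1, 0, 0]]"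

definition half_turn :: "real^3^3" where
  "half_turn = vector [vector [- 1, 0, 0], vector [0, - 1, 0], vector [0, 0, 1]]"

definition quarter_turn :: "real^3^3" where
  "quarter_turn = vector [vector [1, 0, 0], vector [0, 0, - 1], vector [0, 1, 0]]"

lemma rotation_matrices:
  "rotation_matrix cube_diagonal_rotation" "rotation_matrix half_turn" "rotation_matrix quarter_turn"
  by (rule rotation_matrix_3I;
      simp add: cube_diagonal_rotation_def half_turn_def quarter_turn_def inner_vec_def sum_3 det_3)+

lemma rotation_vectors:
  "cube_diagonal_rotation *v u = vector [u$2, u$3, u$1]"
  "half_turn *v u = vector [- u$1, - u$2, u$3]"
  "quarter_turn *v u = vector [u$1, - u$3, u$2]"
  by (simp_all add: matrix_vector_mult_3 cube_diagonal_rotation_def half_turn_def quarter_turn_def)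

text \<open>Each of the rotations permutes the six edge directions up to sign.\<close>

lemma oct_width_rotations:
  "oct_width (cube_diagonal_rotation *v u) = oct_width u"
  "oct_width (half_turn *v u) = oct_width u"
  "oct_width (quarter_turn *v u) = oct_width u"
proof -
  have *: "\<bar>- a - b\<bar> = \<bar>a + b\<bar>" "\<bar>- a + b\<bar> = \<bar>a - b\<bar>" "\<bar>b - a\<bar> = \<bar>a - b\<bar>" for a b :: real
    by linarith+
  show "oct_width (cube_diagonal_rotation *v u) = oct_width u"
    by (simp add: oct_width_def rotation_vectors add.commute *(3)[of "u$2" "u$1"] *(3)[of "u$3" "u$1"])
  show "oct_width (half_turn *v u) = oct_width u"
    by (simp add: oct_width_def rotation_vectors *(1,2))
  show "oct_width (quarter_turn *v u) = oct_width u"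
    by (simp add: oct_width_def rotation_vectors *(1,2))
qed

context rotation_invariant_sphere
begin

text \<open>Up to a null set, the preimages of \<open>C\<close> under the first \<open>k\<close>
  powers of \<open>Q\<close> partition \<open>D\<close>. As \<open>F\<close> and the law are
  invariant under \<open>Q\<close>, every piece contributes the same integral.\<close>

lemma nn_integral_sum_rotations:
  fixes Q :: "real^3^3" and F :: "real^3 \<Rightarrow> ennreal"
  assumes Q: "rotation_matrix Q" and inv: "\<And>u. F (Q *v u) = F u"
    and [measurable]: "F \<in> borel_measurable borel" "C \<in> sets borel"
    and part: "AE u in N. (\<Sum>i<k. indicator C (((*v) Q ^^ i) u)) = (indicator D u :: ennreal)"
  shows "(\<integral>\<^sup>+u. F u * indicator D u \<partial>N) = of_nat k * (\<integral>\<^sup>+u. F u * indicator C u \<partial>N)"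
proof -
  have [measurable]: "(*v) Q \<in> borel_measurable borel" by (rule measurable_matrix_vector_mult)
  have meas[measurable]: "((*v) Q ^^ i) \<in> borel_measurable borel" for i
    by (induction i) simp_all
  have inv': "F (((*v) Q ^^ i) u) = F u" for i u
    by (induction i) (simp_all add: inv)
  have each: "(\<integral>\<^sup>+u. F u * indicator C (((*v) Q ^^ i) u) \<partial>N) = (\<integral>\<^sup>+u. F u * indicator C u \<partial>N)" for i
  proof (induction i)
    case (Suc i)
    have "(\<integral>\<^sup>+u. F u * indicator C (((*v) Q ^^ Suc i) u) \<partial>N)
        = (\<integral>\<^sup>+u. F (Q *v u) * indicator C (((*v) Q ^^ i) (Q *v u)) \<partial>N)"
      by (simp add: funpow_swap1 inv)
    also have "\<dots> = (\<integral>\<^sup>+u. F u * indicator C (((*v) Q ^^ i) u) \<partial>N)"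
      by (rule nn_integral_rotation[OF Q]) measurable
    finally show ?case using Suc by simp
  qed simp
  have "(\<integral>\<^sup>+u. F u * indicator D u \<partial>N) = (\<integral>\<^sup>+u. (\<Sum>i<k. F u * indicator C (((*v) Q ^^ i) u)) \<partial>N)"
    using part by (intro nn_integral_cong_AE) (auto elim!: eventually_mono simp flip: sum_distrib_left)
  also have "\<dots> = (\<Sum>i<k. (\<integral>\<^sup>+u. F u * indicator C (((*v) Q ^^ i) u) \<partial>N))"
    by (rule nn_integral_sum) (simp cong: measurable_cong_sets)
  finally show ?thesis by (simp add: each)
qed

text \<open>Equality of the absolute values describes the union of two planes through the
  origin.\<close>

lemma AE_abs_coordinates_neq:
  assumes "i \<noteq> j"
  shows "AE u in N. \<bar>u$i\<bar> \<noteq> \<bar>u$j\<bar>"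
proof -
  have "axis i 1 + axis j 1 \<noteq> (0 :: real^3)" "axis i 1 - axis j 1 \<noteq> (0 :: real^3)"
    using assms by (auto simp: vec_eq_iff axis_def)
  then have "AE u in N. u \<bullet> (axis i 1 + axis j 1) \<noteq> 0" "AE u in N. u \<bullet> (axis i 1 - axis j 1) \<noteq> 0"
    by (auto intro: AE_inner_neq_0)
  then show ?thesis
    by eventually_elim (auto simp: inner_add_right inner_diff_right inner_axis abs_eq_iff)
qed

text \<open>Three stages with factors 3, 2 and 4: the cyclic shift brings the coordinate of largest
  absolute value to the front (\<open>?A\<close>), the half turn makes it positive
  (\<open>?B\<close>), and the quarter turn arranges the other two (\<open>?C\<close>).\<close>

lemma nn_integral_chamber:
  fixes F :: "real \<Rightarrow> ennreal"
  assumes [measurable]: "F \<in> borel_measurable borel"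
  shows "(\<integral>\<^sup>+u. F (oct_width u) \<partial>N) = 24 * (\<integral>\<^sup>+u. F (oct_width u) * indicator {u. u$1 > u$2 \<and> u$2 > \<bar>u$3\<bar>} u \<partial>N)"
proof -
  let ?F = "\<lambda>u. F (oct_width u)"
  let ?A = "{u::real^3. \<bar>u$1\<bar> > \<bar>u$2\<bar> \<and> \<bar>u$1\<bar> > \<bar>u$3\<bar>}"
  let ?B = "{u::real^3. u$1 > \<bar>u$2\<bar> \<and> u$1 > \<bar>u$3\<bar>}"
  let ?C = "{u::real^3. u$1 > u$2 \<and> u$2 > \<bar>u$3\<bar>}"
  have [measurable]: "?A \<in> sets borel" "?B \<in> sets borel" "?C \<in> sets borel"
    by measurable
  have AE: "AE u in N. \<bar>u$1\<bar> \<noteq> \<bar>u$2\<bar> \<and> \<bar>u$1\<bar> \<noteq> \<bar>u$3\<bar> \<and> \<bar>u$2\<bar> \<noteq> \<bar>u$3\<bar>"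
    using AE_abs_coordinates_neq[of 1 2] AE_abs_coordinates_neq[of 1 3] AE_abs_coordinates_neq[of 2 3]
    by simp
  have sums: "(\<Sum>i<2. f i) = f 0 + f 1" "(\<Sum>i<3. f i) = f 0 + f 1 + f 2"
    "(\<Sum>i<4. f i) = f 0 + f 1 + f 2 + f 3" for f :: "nat \<Rightarrow> ennreal"
    by (simp_all add: eval_nat_numeral add_ac)
  have "(\<integral>\<^sup>+u. ?F u \<partial>N) = (\<integral>\<^sup>+u. ?F u * indicator UNIV u \<partial>N)" by simp
  also have "\<dots> = of_nat 3 * (\<integral>\<^sup>+u. ?F u * indicator ?A u \<partial>N)"
  proof (rule nn_integral_sum_rotations[OF rotation_matrices(1)])
    show "AE u in N. (\<Sum>i<3. indicator ?A (((*v) cube_diagonal_rotation ^^ i) u)) = (indicator UNIV u :: ennreal)"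
      using AE
    proof eventually_elim
      case (elim u)
      then show ?case
        unfolding sums by (auto simp: eval_nat_numeral rotation_vectors indicator_def)
    qed
  qed (simp_all add: oct_width_rotations)
  also have "(\<integral>\<^sup>+u. ?F u * indicator ?A u \<partial>N) = of_nat 2 * (\<integral>\<^sup>+u. ?F u * indicator ?B u \<partial>N)"
  proof (rule nn_integral_sum_rotations[OF rotation_matrices(2)])
    show "AE u in N. (\<Sum>i<2. indicator ?B (((*v) half_turn ^^ i) u)) = (indicator ?A u :: ennreal)"
      using AE
    proof eventually_elim
      case (elim u)
      then show ?case
        unfolding sums by (auto simp: eval_nat_numeral rotation_vectors indicator_def abs_if split: if_splits)
    qed
  qed (simp_all add: oct_width_rotations)
  also have "(\<integral>\<^sup>+u. ?F u * indicator ?B u \<partial>N) = of_nat 4 * (\<integral>\<^sup>+u. ?F u * indicator ?C u \<partial>N)"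
  proof (rule nn_integral_sum_rotations[OF rotation_matrices(3)])
    \<comment> \<open>The last two coordinates run through (y, z), (-z, y), (-y, -z), (z, -y). When
      |y| and |z| differ, exactly one of these pairs has its first entry above the absolute value of
      its second.\<close>
    show "AE u in N. (\<Sum>i<4. indicator ?C (((*v) quarter_turn ^^ i) u)) = (indicator ?B u :: ennreal)"
      using AE
    proof eventually_elim
      case (elim u)
      then show ?case
        unfolding sums by (auto simp: eval_nat_numeral rotation_vectors indicator_def abs_if split: if_splits)
    qed
  qed (simp_all add: oct_width_rotations)
  finally show ?thesis by (simp flip: mult.assoc)
qed

end

subsection \<open>Averaging over rotations about an axis\<close>

lemma nn_integral_lborel_shift:
  fixes f :: "real \<Rightarrow> ennreal"
  assumes "f \<in> borel_measurable borel"
  shows "(\<integral>\<^sup>+x. f x \<partial>lborel) = (\<integral>\<^sup>+x. f (t + x) \<partial>lborel)"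
  using nn_integral_real_affine[OF assms, of 1 t] by simp

text \<open>The shifted period is cut at \<open>pi\<close>, and the part beyond \<open>pi\<close> is
  moved back by \<open>2 * pi\<close>.\<close>

lemma nn_integral_periodic_shift:
  fixes f :: "real \<Rightarrow> ennreal"
  assumes [measurable]: "f \<in> borel_measurable borel"
    and per: "\<And>x. f (2 * pi + x) = f x" and \<alpha>: "0 \<le> \<alpha>" "\<alpha> \<le> 2 * pi"
  shows "(\<integral>\<^sup>+x. f (\<alpha> + x) * indicator {-pi..<pi} x \<partial>lborel) = (\<integral>\<^sup>+x. f x * indicator {-pi..<pi} x \<partial>lborel)"
proof -
  have "(\<integral>\<^sup>+x. f x * indicator {\<alpha> - pi..<\<alpha> + pi} x \<partial>lborel)
      = (\<integral>\<^sup>+x. f (\<alpha> + x) * indicator {\<alpha> - pi..<\<alpha> + pi} (\<alpha> + x) \<partial>lborel)"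
    by (rule nn_integral_lborel_shift) simp
  also have "\<dots> = (\<integral>\<^sup>+x. f (\<alpha> + x) * indicator {-pi..<pi} x \<partial>lborel)"
    by (intro nn_integral_cong) (auto split: split_indicator)
  finally have "(\<integral>\<^sup>+x. f (\<alpha> + x) * indicator {-pi..<pi} x \<partial>lborel)
      = (\<integral>\<^sup>+x. f x * indicator {\<alpha> - pi..<\<alpha> + pi} x \<partial>lborel)" ..
  also have "\<dots> = (\<integral>\<^sup>+x. f x * indicator {\<alpha> - pi..<pi} x + f x * indicator {pi..<\<alpha> + pi} x \<partial>lborel)"
    using \<alpha> by (intro nn_integral_cong) (auto split: split_indicator)
  also have "\<dots> = (\<integral>\<^sup>+x. f x * indicator {\<alpha> - pi..<pi} x \<partial>lborel) + (\<integral>\<^sup>+x. f x * indicator {pi..<\<alpha> + pi} x \<partial>lborel)"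
    by (rule nn_integral_add) simp_all
  also have "(\<integral>\<^sup>+x. f x * indicator {pi..<\<alpha> + pi} x \<partial>lborel)
      = (\<integral>\<^sup>+x. f (2 * pi + x) * indicator {pi..<\<alpha> + pi} (2 * pi + x) \<partial>lborel)"
    by (rule nn_integral_lborel_shift) simp
  also have "\<dots> = (\<integral>\<^sup>+x. f x * indicator {-pi..<\<alpha> - pi} x \<partial>lborel)"
    unfolding per by (intro nn_integral_cong) (auto split: split_indicator)
  also have "(\<integral>\<^sup>+x. f x * indicator {\<alpha> - pi..<pi} x \<partial>lborel) + (\<integral>\<^sup>+x. f x * indicator {-pi..<\<alpha> - pi} x \<partial>lborel)
      = (\<integral>\<^sup>+x. f x * indicator {\<alpha> - pi..<pi} x + f x * indicator {-pi..<\<alpha> - pi} x \<partial>lborel)"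
    by (rule nn_integral_add[symmetric]) simp_all
  also have "\<dots> = (\<integral>\<^sup>+x. f x * indicator {-pi..<pi} x \<partial>lborel)"
    using \<alpha> by (intro nn_integral_cong) (auto split: split_indicator)
  finally show ?thesis .
qed

lemma measurable_vec_nth_comp [measurable (raw)]:
  "f \<in> borel_measurable M \<Longrightarrow> (\<lambda>x. (f x :: real^'n) $ i) \<in> borel_measurable M"
  by (rule measurable_compose[OF _ borel_measurable_nth])

lemma measurable_vector_3 [measurable (raw)]:
  assumes [measurable]: "f \<in> borel_measurable M" "g \<in> borel_measurable M" "h \<in> borel_measurable M"
  shows "(\<lambda>x. vector [f x, g x, h x] :: real^3) \<in> borel_measurable M"
proof -
  have "(vector [f x, g x, h x] :: real^3) = f x *\<^sub>R axis 1 1 + g x *\<^sub>R axis 2 1 + h x *\<^sub>R axis 3 1" for x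
    by (simp add: vec_eq_iff forall_3 axis_def)
  then show ?thesis by simp
qed

definition axial_rotation :: "real \<Rightarrow> real^3^3" where
  "axial_rotation \<theta> = vector [vector [cos \<theta>, - sin \<theta>, 0], vector [sin \<theta>, cos \<theta>, 0], vector [0, 0, 1]]"

lemma rotation_matrix_axial: "rotation_matrix (axial_rotation \<theta>)"
  by (rule rotation_matrix_3I)
    (simp_all add: axial_rotation_def inner_vec_def sum_3 det_3 flip: power2_eq_square)

context rotation_invariant_sphere
begin

text \<open>Invariance under rotations about the third axis is integrated over the angle, and Fubini
  swaps the integrals. For fixed \<open>u\<close> the inner integral then runs over the circle at
  height \<open>u$3\<close>, and by periodicity it does not depend on the azimuth of
  \<open>u\<close>.\<close>

lemma nn_integral_azimuth:
  fixes G :: "real^3 \<Rightarrow> ennreal"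
  assumes [measurable]: "G \<in> borel_measurable borel"
  shows "(\<integral>\<^sup>+u. G u \<partial>N) = ennreal (1 / (2 * pi)) *
    (\<integral>\<^sup>+u. (\<integral>\<^sup>+\<phi>. G (vector [sqrt (1 - (u$3)\<^sup>2) * cos \<phi>, sqrt (1 - (u$3)\<^sup>2) * sin \<phi>, u$3])
        * indicator {-pi..<pi} \<phi> \<partial>lborel) \<partial>N)"
    (is "_ = _ * ?R")
proof -
  interpret P: pair_sigma_finite lborel N
    by (intro pair_sigma_finite.intro sigma_finite_lborel sigma_finite_measure_axioms)
  have ax: "axial_rotation \<theta> *v u = vector [cos \<theta> * u$1 - sin \<theta> * u$2, sin \<theta> * u$1 + cos \<theta> * u$2, u$3]" for \<theta> u
    by (simp add: matrix_vector_mult_3 axial_rotation_def)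
  have "(\<integral>\<^sup>+\<theta>. (\<integral>\<^sup>+u. G (axial_rotation \<theta> *v u) * indicator {-pi..<pi} \<theta> \<partial>N) \<partial>lborel)
      = (\<integral>\<^sup>+\<theta>. (\<integral>\<^sup>+u. G u \<partial>N) * indicator {-pi..<pi} \<theta> \<partial>lborel)"
  proof (rule nn_integral_cong)
    fix \<theta> :: real
    have "(\<integral>\<^sup>+u. G (axial_rotation \<theta> *v u) * indicator {-pi..<pi} \<theta> \<partial>N)
      = (\<integral>\<^sup>+u. G (axial_rotation \<theta> *v u) \<partial>N) * indicator {-pi..<pi} \<theta>"
      unfolding ax by (rule nn_integral_multc) (simp cong: measurable_cong_sets)
    then show "(\<integral>\<^sup>+u. G (axial_rotation \<theta> *v u) * indicator {-pi..<pi} \<theta> \<partial>N) = (\<integral>\<^sup>+u. G u \<partial>N) * indicator {-pi..<pi} \<theta>"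
      by (simp add: nn_integral_rotation[OF rotation_matrix_axial])
  qed
  also have "\<dots> = (\<integral>\<^sup>+u. G u \<partial>N) * ennreal (2 * pi)"
    by (simp add: nn_integral_cmult_indicator)
  also have "(\<integral>\<^sup>+\<theta>. (\<integral>\<^sup>+u. G (axial_rotation \<theta> *v u) * indicator {-pi..<pi} \<theta> \<partial>N) \<partial>lborel)
      = (\<integral>\<^sup>+u. (\<integral>\<^sup>+\<theta>. G (axial_rotation \<theta> *v u) * indicator {-pi..<pi} \<theta> \<partial>lborel) \<partial>N)"
    unfolding ax by (rule P.Fubini'[symmetric]) (simp add: case_prod_unfold cong: measurable_cong_sets)
  also have "\<dots> = ?R"
  proof (rule nn_integral_cong_AE)
    show "AE u in N. (\<integral>\<^sup>+\<theta>. G (axial_rotation \<theta> *v u) * indicator {-pi..<pi} \<theta> \<partial>lborel)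
      = (\<integral>\<^sup>+\<phi>. G (vector [sqrt (1 - (u$3)\<^sup>2) * cos \<phi>, sqrt (1 - (u$3)\<^sup>2) * sin \<phi>, u$3])
        * indicator {-pi..<pi} \<phi> \<partial>lborel)"
      using AE_norm
    proof eventually_elim
      case (elim u)
      define \<rho> where "\<rho> = sqrt (1 - (u$3)\<^sup>2)"
      have "u \<bullet> u = 1" using elim by (simp add: norm_eq_1)
      then have s: "(u$1)\<^sup>2 + (u$2)\<^sup>2 = 1 - (u$3)\<^sup>2"
        by (simp add: inner_vec_def sum_3 power2_eq_square)
      then have "1 - (u$3)\<^sup>2 \<ge> 0" by (metis sum_power2_ge_zero)
      then have \<rho>2: "(u$1)\<^sup>2 + (u$2)\<^sup>2 = \<rho>\<^sup>2" using s by (simp add: \<rho>_def)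
      obtain \<alpha> where \<alpha>: "0 \<le> \<alpha>" "\<alpha> \<le> 2 * pi" "u$1 = \<rho> * cos \<alpha>" "u$2 = \<rho> * sin \<alpha>"
      proof (cases "\<rho> = 0")
        \<comment> \<open>At a pole every azimuth fits; 0 is chosen.\<close>
        case True
        then show ?thesis using \<rho>2 that[of 0] by (simp add: sum_power2_eq_zero_iff)
      next
        case False
        then have "(u$1 / \<rho>)\<^sup>2 + (u$2 / \<rho>)\<^sup>2 = 1"
          using \<rho>2 by (simp add: power_divide flip: add_divide_distrib)
        then obtain t where "0 \<le> t" "t < 2 * pi" "u$1 / \<rho> = cos t" "u$2 / \<rho> = sin t"
          by (rule sincos_total_2pi)
        then show ?thesis using False by (intro that[of t]) (auto simp: field_simps)
      qed
      have "axial_rotation \<theta> *v u = vector [\<rho> * cos (\<alpha> + \<theta>), \<rho> * sin (\<alpha> + \<theta>), u$3]" for \<theta>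
        unfolding ax \<alpha> cos_add sin_add by (simp add: algebra_simps)
      moreover have "(\<integral>\<^sup>+\<theta>. G (vector [\<rho> * cos (\<alpha> + \<theta>), \<rho> * sin (\<alpha> + \<theta>), u$3]) * indicator {-pi..<pi} \<theta> \<partial>lborel)
          = (\<integral>\<^sup>+\<phi>. G (vector [\<rho> * cos \<phi>, \<rho> * sin \<phi>, u$3]) * indicator {-pi..<pi} \<phi> \<partial>lborel)"
        by (rule nn_integral_periodic_shift) (use \<alpha> in \<open>simp_all add: cos_add sin_add\<close>)
      ultimately show ?case unfolding \<rho>_def by simp
    qed
  qed
  finally have eq: "?R = (\<integral>\<^sup>+u. G u \<partial>N) * ennreal (2 * pi)" .
  have "ennreal (1 / (2 * pi)) * ennreal (2 * pi) = 1"
    by (subst ennreal_mult[symmetric]) auto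
  then show ?thesis
    unfolding eq by (metis mult.commute mult.left_commute mult.right_neutral)
qed

end

subsection \<open>Arc lengths\<close>

text \<open>The lower bound, from -2/3 < -1/2, says that \<open>pi - width_theta\<close> is below
  \<open>pi / 3\<close>. This later makes \<open>3 * arccos k < pi\<close> strict.\<close>

lemma width_theta_bounds: "2 * pi / 3 < width_theta" "width_theta < pi"
  and cos_width_theta: "cos width_theta = - 2 / 3"
  and sin_width_theta: "sin width_theta = sqrt 5 / 3"
proof -
  show c: "cos width_theta = - 2 / 3" unfolding width_theta_def by (rule cos_arccos) auto
  have r: "0 \<le> width_theta" "width_theta \<le> pi" unfolding width_theta_def
    by (auto intro!: arccos_lbound arccos_ubound)
  have "cos width_theta < cos (2 * pi / 3)" using c cos_120 by simp
  then show "2 * pi / 3 < width_theta"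
    using r by (subst (asm) cos_mono_less_eq) auto
  have "cos pi < cos width_theta" using c by simp
  then show "width_theta < pi"
    using r by (subst (asm) cos_mono_less_eq) auto
  have "(sin width_theta)\<^sup>2 = 5 / 9" using c sin_squared_eq[of width_theta] by (simp add: power2_eq_square)
  moreover have "sin width_theta \<ge> 0" using r by (intro sin_ge_zero) auto
  ultimately have "sin width_theta = sqrt (5 / 9)" by (metis real_sqrt_unique)
  also have "\<dots> = sqrt 5 / 3" using real_sqrt_divide[of 5 9] real_sqrt_abs[of 3] by simp
  finally show "sin width_theta = sqrt 5 / 3" .
qed

text \<open>Half-angle formula. The value is the threshold of \<open>k\<close> below which no arc is
  left; it is reached at \<open>t = sqrt 6\<close>.\<close>

lemma cos_half_width_theta: "cos (width_theta / 2) = sqrt 6 / 6"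
proof -
  have "cos width_theta = 2 * (cos (width_theta / 2))\<^sup>2 - 1"
    using cos_double_cos[of "width_theta / 2"] by simp
  then have "(cos (width_theta / 2))\<^sup>2 = 1 / 6" using cos_width_theta by simp
  moreover have "cos (width_theta / 2) \<ge> 0" using width_theta_bounds by (intro cos_ge_zero) auto
  ultimately have "cos (width_theta / 2) = sqrt (1 / 6)" by (metis real_sqrt_unique)
  also have "\<dots> = sqrt 6 / 6" by (simp add: real_sqrt_divide field_simps)
  finally show ?thesis .
qed

text \<open>The angles \<open>\<phi>\<close> for which the point of azimuth \<open>\<phi>\<close> on the circle at height \<open>t / sqrt 10\<close> lies in
  \<open>C\<close>, where \<open>k = t / (3 * sqrt (10 - t\<^sup>2))\<close>.\<close>
definition arc_set :: "real \<Rightarrow> real set" where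
  "arc_set k = {\<phi>. - pi \<le> \<phi> \<and> \<phi> < pi \<and> cos \<phi> > - k \<and> (2 * cos \<phi> + sqrt 5 * \<bar>sin \<phi>\<bar>) / 3 < k}"

text \<open>By the addition formula the second condition is a cosine shifted by
  \<open>width_theta\<close>. The absolute value of the angle treats the two walls that are mirror
  images of each other at once.\<close>

lemma arc_set_eq_cos:
  "arc_set k = {\<phi>. - pi \<le> \<phi> \<and> \<phi> < pi \<and> cos \<bar>\<phi>\<bar> > - k \<and> cos (\<bar>\<phi>\<bar> + width_theta) > - k}"
proof -
  have "\<bar>sin \<phi>\<bar> = sin \<bar>\<phi>\<bar>" if "- pi \<le> \<phi>" "\<phi> < pi" for \<phi>
    using that sin_ge_zero[of "\<bar>\<phi>\<bar>"] by (auto simp: abs_if split: if_splits)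
  then show ?thesis
    unfolding arc_set_def cos_add cos_width_theta sin_width_theta
    by (auto simp: algebra_simps add_divide_distrib)
qed

text \<open>Each cosine inequality removes a gap of half-width \<open>arccos k\<close>; the centres
  are \<open>pi\<close> and, with its mirror image, \<open>pi - width_theta\<close>.\<close>

lemma arc_set_eq:
  assumes "- 1 \<le> k" "k \<le> 1"
  shows "arc_set k = {\<phi>. - pi \<le> \<phi> \<and> \<phi> < pi \<and> \<bar>\<phi>\<bar> < pi - arccos k
    \<and> arccos k < \<bar>\<bar>\<phi>\<bar> + width_theta - pi\<bar>}"
proof -
  define b where "b = arccos k"
  have b: "0 \<le> b" "b \<le> pi" "cos b = k"
    using assms by (auto simp: b_def arccos_lbound arccos_ubound)
  have "(cos \<bar>\<phi>\<bar> > - k \<longleftrightarrow> \<bar>\<phi>\<bar> < pi - b) \<and> (cos (\<bar>\<phi>\<bar> + width_theta) > - k \<longleftrightarrow> b < \<bar>\<bar>\<phi>\<bar> + width_theta - pi\<bar>)"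
    if "- pi \<le> \<phi>" "\<phi> < pi" for \<phi>
  proof
    have "- k = cos (pi - b)" using b by simp
    then show "cos \<bar>\<phi>\<bar> > - k \<longleftrightarrow> \<bar>\<phi>\<bar> < pi - b"
      using that b by (simp only:) (subst cos_mono_less_eq; auto)
    \<comment> \<open>The signed distance of the absolute angle from the gap centre
      \<open>pi - width_theta\<close>. It stays within [-pi, pi], so evenness and monotonicity of
      the cosine apply.\<close>
    define \<psi> where "\<psi> = \<bar>\<phi>\<bar> + width_theta - pi"
    have \<psi>: "\<bar>\<psi>\<bar> \<le> pi" using that width_theta_bounds by (auto simp: \<psi>_def)
    have "cos (\<bar>\<phi>\<bar> + width_theta) = cos (\<psi> + pi)" by (simp add: \<psi>_def)
    also have "\<dots> = - cos \<bar>\<psi>\<bar>" by simp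
    finally have "cos (\<bar>\<phi>\<bar> + width_theta) > - k \<longleftrightarrow> cos \<bar>\<psi>\<bar> < cos b" using b by simp
    also have "\<dots> \<longleftrightarrow> b < \<bar>\<psi>\<bar>"
      using \<psi> b by (intro cos_mono_less_eq) auto
    finally show "cos (\<bar>\<phi>\<bar> + width_theta) > - k \<longleftrightarrow> b < \<bar>\<bar>\<phi>\<bar> + width_theta - pi\<bar>"
      by (simp add: \<psi>_def)
  qed
  then show ?thesis unfolding arc_set_eq_cos b_def[symmetric] by blast
qed

text \<open>If \<open>arccos k\<close> exceeds half of \<open>width_theta\<close>, each side gap
  meets the gap around \<open>pi\<close> and also reaches past 0, so nothing remains. For
  \<open>k < - 1\<close> the first condition already fails.\<close>

lemma emeasure_arc_set_empty:
  assumes "k < cos (width_theta / 2)"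
  shows "emeasure lborel (arc_set k) = 0"
proof (cases "- 1 \<le> k")
  case True
  have k1: "k \<le> 1" using assms cos_le_one[of "width_theta / 2"] by linarith
  have "cos (arccos k) < cos (width_theta / 2)" using True k1 assms by simp
  then have "width_theta / 2 < arccos k"
    using True k1 width_theta_bounds by (subst (asm) cos_mono_less_eq) (auto simp: arccos_lbound arccos_ubound)
  then have "arc_set k = {}"
    unfolding arc_set_eq[OF True k1] using width_theta_bounds by (auto simp: abs_if split: if_splits)
  then show ?thesis by simp
next
  case False
  have "\<not> cos \<phi> > - k" for \<phi> using False cos_le_one[of \<phi>] by linarith
  then have "arc_set k = {}" unfolding arc_set_def by blast
  then show ?thesis by simp
qed

text \<open>Here \<open>arccos k\<close> is at least \<open>pi - width_theta\<close>, so the two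
  side gaps merge across 0. There remain two mirror arcs, each of length
  \<open>width_theta - 2 * arccos k\<close>.\<close>

lemma emeasure_arc_set_two_gaps:
  assumes "cos (width_theta / 2) \<le> k" "k \<le> 2 / 3"
  shows "emeasure lborel (arc_set k) = ennreal (2 * (width_theta - 2 * arccos k))"
    and "2 * arccos k \<le> width_theta"
proof -
  define b where "b = arccos k"
  have pos: "cos (width_theta / 2) > 0" using width_theta_bounds by (intro cos_gt_zero) auto
  have k: "- 1 \<le> k" "k \<le> 1" using assms pos by auto
  have b: "0 \<le> b" "b \<le> pi" "cos b = k"
    using k by (auto simp: b_def arccos_lbound arccos_ubound)
  have "cos (width_theta / 2) \<le> cos b" using b assms by simp
  then have b1: "2 * b \<le> width_theta"
    using b width_theta_bounds by (subst (asm) cos_mono_le_eq) auto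
  have "cos b \<le> cos (pi - width_theta)" using b assms by (simp add: cos_width_theta)
  then have b2: "pi - width_theta \<le> b"
    using b width_theta_bounds by (subst (asm) cos_mono_le_eq) auto
  let ?l = "pi - width_theta + b" and ?r = "pi - b"
  have "arc_set k = {- ?r<..<- ?l} \<union> {?l<..<?r}"
    unfolding arc_set_eq[OF k] b_def[symmetric] using width_theta_bounds b b1 b2
    by (auto simp: abs_if split: if_splits)
  also have "emeasure lborel \<dots> = emeasure lborel {- ?r<..<- ?l} + emeasure lborel {?l<..<?r}"
    using b width_theta_bounds by (intro plus_emeasure[symmetric]) auto
  also have "\<dots> = ennreal (2 * (width_theta - 2 * b))"
    using b1 by (simp flip: ennreal_plus)
  finally show "emeasure lborel (arc_set k) = ennreal (2 * (width_theta - 2 * arccos k))"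
    by (simp add: b_def)
  show "2 * arccos k \<le> width_theta" using b1 by (simp add: b_def)
qed

text \<open>Now the side gaps no longer overlap at 0, and a third arc, centred at 0, appears between
  them. The three gaps together take \<open>6 * arccos k\<close> away from the full circle.\<close>

lemma emeasure_arc_set_three_gaps:
  assumes "2 / 3 \<le> k" "k \<le> 1"
  shows "emeasure lborel (arc_set k) = ennreal (2 * (pi - 3 * arccos k))"
    and "3 * arccos k < pi"
proof -
  define b where "b = arccos k"
  have k: "- 1 \<le> k" "k \<le> 1" using assms by auto
  have b: "0 \<le> b" "b \<le> pi" "cos b = k"
    using k by (auto simp: b_def arccos_lbound arccos_ubound)
  have "cos b \<ge> cos (pi - width_theta)" using b assms by (simp add: cos_width_theta)
  then have b2: "b \<le> pi - width_theta"
    using b width_theta_bounds by (subst (asm) cos_mono_le_eq) auto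
  let ?l = "pi - width_theta + b" and ?r = "pi - b" and ?q = "pi - width_theta - b"
  have "arc_set k = ({- ?r<..<- ?l} \<union> {?l<..<?r}) \<union> {- ?q<..<?q}"
    unfolding arc_set_eq[OF k] b_def[symmetric] using width_theta_bounds b b2
    by (auto simp: abs_if split: if_splits)
  also have "emeasure lborel \<dots> = emeasure lborel ({- ?r<..<- ?l} \<union> {?l<..<?r}) + emeasure lborel {- ?q<..<?q}"
    using b width_theta_bounds by (intro plus_emeasure[symmetric]) auto
  also have "emeasure lborel ({- ?r<..<- ?l} \<union> {?l<..<?r}) = emeasure lborel {- ?r<..<- ?l} + emeasure lborel {?l<..<?r}"
    using b width_theta_bounds by (intro plus_emeasure[symmetric]) auto
  also have "\<dots> + emeasure lborel {- ?q<..<?q} = ennreal (2 * (pi - 3 * b))"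
    using b2 b width_theta_bounds by (simp flip: ennreal_plus)
  finally show "emeasure lborel (arc_set k) = ennreal (2 * (pi - 3 * arccos k))"
    by (simp add: b_def)
  show "3 * arccos k < pi" using b2 width_theta_bounds by (simp add: b_def)
qed

text \<open>For \<open>k = 1\<close> the gaps shrink to points, and for larger \<open>k\<close> both
  cosine conditions always hold.\<close>

lemma emeasure_arc_set_full:
  assumes "1 \<le> k"
  shows "emeasure lborel (arc_set k) = ennreal (2 * pi)"
proof (cases "k = 1")
  case True
  then show ?thesis using emeasure_arc_set_three_gaps(1)[of 1] by simp
next
  case False
  then have "cos x > - k" for x using cos_ge_minus_one[of x] assms by linarith
  then have "arc_set k = {-pi..<pi}" unfolding arc_set_eq_cos by auto
  then show ?thesis by simp
qed

text \<open>For nonnegative arguments the numerator grows and the denominator falls; the function is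
  odd, which settles the other signs.\<close>

lemma slope_strict_mono:
  assumes "s < t" "- sqrt 10 < s" "t < sqrt 10"
  shows "s / (3 * sqrt (10 - s\<^sup>2)) < t / (3 * sqrt (10 - t\<^sup>2))"
proof -
  have lt: "x\<^sup>2 < 10" if "- sqrt 10 < x" "x < sqrt 10" for x :: real
  proof -
    have "\<bar>x\<bar> < sqrt 10" using that by linarith
    then show ?thesis using real_less_rsqrt real_sqrt_abs real_sqrt_less_iff by metis
  qed
  have sp: "s\<^sup>2 < 10" and tp: "t\<^sup>2 < 10" using lt assms by auto
  have pos: "x / (3 * sqrt (10 - x\<^sup>2)) < y / (3 * sqrt (10 - y\<^sup>2))" if "0 \<le> x" "x < y" "y\<^sup>2 < 10" for x y :: real
  proof -
    have "x\<^sup>2 \<le> y\<^sup>2" using that by (intro power_mono) auto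
    then show ?thesis using that by (intro frac_less) auto
  qed
  consider "0 \<le> s" | "s < 0" "0 \<le> t" | "t < 0" by linarith
  then show ?thesis
  proof cases
    case 1
    then show ?thesis using pos assms tp by blast
  next
    case 2
    have "s / (3 * sqrt (10 - s\<^sup>2)) < 0" using 2 sp by (intro divide_neg_pos) auto
    also have "0 \<le> t / (3 * sqrt (10 - t\<^sup>2))" using 2 tp by auto
    finally show ?thesis .
  next
    case 3
    then show ?thesis using pos[of "- t" "- s"] assms sp by auto
  qed
qed

text \<open>The breakpoints of the density are the points where \<open>k\<close> passes the
  thresholds of the arc lengths.\<close>

lemma slope_values:
  "sqrt 6 / (3 * sqrt (10 - (sqrt 6)\<^sup>2)) = cos (width_theta / 2)"
  "2 * sqrt 2 / (3 * sqrt (10 - (2 * sqrt 2)\<^sup>2)) = 2 / 3"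
  "3 / (3 * sqrt (10 - 3\<^sup>2)) = (1 :: real)"
proof -
  have "sqrt 4 = (2 :: real)" using real_sqrt_abs[of 2] by simp
  then show "sqrt 6 / (3 * sqrt (10 - (sqrt 6)\<^sup>2)) = cos (width_theta / 2)"
    by (simp add: cos_half_width_theta)
qed (simp_all add: power_mult_distrib)

lemma width_breakpoints:
  "0 < sqrt 6" "sqrt 6 < 2 * sqrt 2" "2 * sqrt 2 < 3" "3 < sqrt 10"
proof -
  have "2 * sqrt 2 = sqrt 8" by (rule real_sqrt_unique[symmetric]) (simp_all add: power_mult_distrib)
  moreover have "sqrt 8 < 3" "3 < sqrt 10" by (simp_all add: real_less_rsqrt real_less_lsqrt)
  ultimately show "sqrt 6 < 2 * sqrt 2" "2 * sqrt 2 < 3" "3 < sqrt 10" by simp_all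
qed simp

text \<open>The factor is \<open>2 * pi\<close> times \<open>sqrt 10 / 12\<close>, since the density
  is \<open>12 / sqrt 10\<close> times the share of the circle inside the chamber. Monotonicity of
  the slope turns ranges of \<open>t\<close> into ranges of \<open>k\<close>.\<close>

lemma emeasure_arc_set_density:
  assumes "- sqrt 10 < t" "t < sqrt 10"
  shows "emeasure lborel (arc_set (t / (3 * sqrt (10 - t\<^sup>2)))) = ennreal (pi * sqrt 10 / 6 * trunc_oct_width_density t)"
proof -
  let ?k = "\<lambda>t::real. t / (3 * sqrt (10 - t\<^sup>2))"
  note bp = width_breakpoints
  have mono: "?k x < ?k y" if "x < y" "- sqrt 10 < x" "y < sqrt 10" for x y :: real
    using slope_strict_mono that by blast
  have mono': "?k x \<le> ?k y" if "x \<le> y" "- sqrt 10 < x" "y < sqrt 10" for x y :: real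
    using mono[of x y] that by (cases "x = y") auto
  consider "t < sqrt 6" | "sqrt 6 \<le> t" "t < 2 * sqrt 2" | "2 * sqrt 2 \<le> t" "t < 3" | "3 \<le> t" by linarith
  then show ?thesis
  proof cases
    case 1
    then have "?k t < cos (width_theta / 2)" using mono[of t "sqrt 6"] assms bp slope_values by auto
    then show ?thesis using 1 by (simp add: emeasure_arc_set_empty trunc_oct_width_density_def)
  next
    case 2
    have "cos (width_theta / 2) \<le> ?k t" "?k t \<le> 2 / 3"
      using mono'[of "sqrt 6" t] mono'[of t "2 * sqrt 2"] 2 assms bp slope_values by auto
    then show ?thesis using 2
      by (simp add: emeasure_arc_set_two_gaps trunc_oct_width_density_def width_beta_def)
  next
    case 3
    have "2 / 3 \<le> ?k t" "?k t \<le> 1"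
      using mono'[of "2 * sqrt 2" t] mono'[of t 3] 3 assms bp slope_values by auto
    then show ?thesis using 3 bp
      by (simp add: emeasure_arc_set_three_gaps trunc_oct_width_density_def width_beta_def)
        (simp add: diff_divide_distrib)
  next
    case 4
    have "1 \<le> ?k t"
      using mono'[of 3 t] 4 assms bp slope_values by auto
    then show ?thesis using 4 bp assms
      by (simp add: emeasure_arc_set_full trunc_oct_width_density_def)
  qed
qed

text \<open>Strict positivity on the open interval is what places the whole closed interval in the
  support. On the first piece it comes from the strict monotonicity of the slope.\<close>

lemma trunc_oct_width_density_pos:
  assumes "sqrt 6 < t" "t < sqrt 10"
  shows "trunc_oct_width_density t > 0"
proof -
  let ?k = "\<lambda>t::real. t / (3 * sqrt (10 - t\<^sup>2))"
  note bp = width_breakpoints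
  have mono: "?k x < ?k y" if "x < y" "- sqrt 10 < x" "y < sqrt 10" for x y :: real
    using slope_strict_mono that by blast
  consider "t < 2 * sqrt 2" | "2 * sqrt 2 \<le> t" "t < 3" | "3 \<le> t" by linarith
  then show ?thesis
  proof cases
    case 1
    have k: "cos (width_theta / 2) < ?k t" "?k t < 2 / 3"
      using mono[of "sqrt 6" t] mono[of t "2 * sqrt 2"] 1 assms bp slope_values by auto
    have "cos (width_theta / 2) > 0" using width_theta_bounds by (intro cos_gt_zero) auto
    then have "- 1 \<le> ?k t" "?k t \<le> 1" using k by linarith+
    then have "cos (width_theta / 2) < cos (arccos (?k t))" "0 \<le> arccos (?k t)" "arccos (?k t) \<le> pi"
      using k by (auto simp: arccos_lbound arccos_ubound)
    then have "2 * width_beta t < width_theta"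
      using width_theta_bounds unfolding width_beta_def by (subst (asm) cos_mono_less_eq) auto
    then show ?thesis using 1 assms by (simp add: trunc_oct_width_density_def)
  next
    case 2
    have "2 / 3 \<le> ?k t" "?k t \<le> 1"
      using mono[of "2 * sqrt 2" t] mono[of t 3] 2 assms bp slope_values by (cases "t = 2 * sqrt 2"; force)+
    from emeasure_arc_set_three_gaps(2)[OF this] show ?thesis
      using 2 assms by (simp add: trunc_oct_width_density_def width_beta_def)
  next
    case 3
    then show ?thesis using assms bp by (simp add: trunc_oct_width_density_def)
  qed
qed

lemma trunc_oct_width_density_eq_0: "t < sqrt 6 \<or> sqrt 10 \<le> t \<Longrightarrow> trunc_oct_width_density t = 0"
  using width_breakpoints by (auto simp: trunc_oct_width_density_def)

lemma trunc_oct_width_density_nonneg: "0 \<le> trunc_oct_width_density t"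
proof -
  \<comment> \<open>The left endpoint falls under the formula of the first nonzero piece but not
    under positivity on the open interval.\<close>
  have "trunc_oct_width_density (sqrt 6) = 0"
  proof -
    have "width_beta (sqrt 6) = width_theta / 2"
      unfolding width_beta_def slope_values using width_theta_bounds by (intro arccos_cos) auto
    then show ?thesis using width_breakpoints by (simp add: trunc_oct_width_density_def)
  qed
  then show ?thesis
    using trunc_oct_width_density_pos[of t] trunc_oct_width_density_eq_0[of t]
    by (metis less_eq_real_def linorder_not_less)
qed

text \<open>\<open>arccos\<close> is continuous on [-1, 1], so \<open>width_beta\<close> is first
  cut down to \<open>{sqrt 6..<3}\<close>, where its argument lies in [0, 1] and where the density
  refers to it.\<close>

lemma measurable_trunc_oct_width_density [measurable]: "trunc_oct_width_density \<in> borel_measurable borel"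
proof -
  let ?k = "\<lambda>t::real. t / (3 * sqrt (10 - t\<^sup>2))"
  note bp = width_breakpoints
  have lt: "t\<^sup>2 < 10" if "0 \<le> t" "t < 3" for t :: real
    using power_strict_mono[of t 3 2] that by simp
  have cont: "continuous_on {sqrt 6..<3} width_beta"
    unfolding width_beta_def
  proof (intro continuous_intros ballI conjI)
    fix t assume t: "t \<in> {sqrt 6..<3}"
    have t0: "0 \<le> t" "t < 3" "0 < t" using t less_le_trans[OF bp(1), of t] by auto
    show "3 * sqrt (10 - t\<^sup>2) \<noteq> 0" using lt[OF t0(1,2)] by simp
    have "0 \<le> ?k t" using lt[OF t0(1,2)] t0 by simp
    then show "- 1 \<le> ?k t" by linarith
    show "?k t \<le> 1" using slope_strict_mono[of t 3] t0 bp slope_values(3) by auto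
  qed
  have [measurable]: "(\<lambda>t. indicator {sqrt 6..<3} t *\<^sub>R width_beta t) \<in> borel_measurable borel"
    using cont by (intro borel_measurable_continuous_on_indicator) auto
  define b where "b t = indicator {sqrt 6..<3} t *\<^sub>R width_beta t" for t
  have [measurable]: "b \<in> borel_measurable borel" unfolding b_def by measurable
  have "trunc_oct_width_density = (\<lambda>t. if t < sqrt 6 then 0
      else if t < 2 * sqrt 2 then 12 / (pi * sqrt 10) * (width_theta - 2 * b t)
      else if t < 3 then 12 / (pi * sqrt 10) * (pi - 3 * b t)
      else if t < sqrt 10 then 12 / sqrt 10
      else 0)"
    using bp by (auto simp: fun_eq_iff trunc_oct_width_density_def b_def)
  also have "\<dots> \<in> borel_measurable borel" by measurable
  finally show ?thesis .
qed

subsection \<open>Density of the width\<close>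

text \<open>The third column is \<open>n\<close>; the first one, orthogonal to \<open>n\<close>, points away from the wall \<open>u\<^sub>1 = u\<^sub>2\<close>.\<close>
definition octahedral_frame :: "real^3^3" where
  "octahedral_frame = vector [vector [1 / sqrt 5, 0, 2 / sqrt 5],
     vector [- (2 / sqrt 5), 0, 1 / sqrt 5], vector [0, - 1, 0]]"

lemma rotation_matrix_frame: "rotation_matrix octahedral_frame"
  by (rule rotation_matrix_3I)
    (simp_all add: octahedral_frame_def inner_vec_def sum_3 det_3)

lemma frame_vector:
  "octahedral_frame *v u = vector [(u$1 + 2 * u$3) / sqrt 5, (u$3 - 2 * u$1) / sqrt 5, - u$2]"
  by (simp add: matrix_vector_mult_3 octahedral_frame_def field_simps)

text \<open>In the rotated frame the walls of the chamber become the two conditions of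
  \<open>arc_set\<close> with slope z / (3 sqrt (1 - z^2)), and the linear form of the width depends
  on the height \<open>z\<close> only.\<close>

lemma frame_oct_width:
  fixes v :: "real^3" and z t \<phi> :: real
  defines "v \<equiv> octahedral_frame *v vector [sqrt (1 - z\<^sup>2) * cos \<phi>, sqrt (1 - z\<^sup>2) * sin \<phi>, z]"
    and "t \<equiv> sqrt 10 * z"
  assumes z: "- 1 < z" "z < 1" and \<phi>: "- pi \<le> \<phi>" "\<phi> < pi"
  shows "v$1 > v$2 \<and> v$2 > \<bar>v$3\<bar> \<longleftrightarrow> \<phi> \<in> arc_set (t / (3 * sqrt (10 - t\<^sup>2)))"
    and "v$1 > v$2 \<Longrightarrow> v$2 > \<bar>v$3\<bar> \<Longrightarrow> oct_width v = t"
proof -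
  define \<rho> where "\<rho> = sqrt (1 - z\<^sup>2)"
  have "z\<^sup>2 < 1" using z by (simp add: abs_square_less_1)
  then have \<rho>: "\<rho> > 0" by (simp add: \<rho>_def)
  have "10 - t\<^sup>2 = 10 * (1 - z\<^sup>2)" by (simp add: t_def power_mult_distrib)
  then have "sqrt (10 - t\<^sup>2) = sqrt 10 * \<rho>" by (simp only: \<rho>_def real_sqrt_mult)
  then have k: "t / (3 * sqrt (10 - t\<^sup>2)) = z / (3 * \<rho>)"
    by (simp only:) (simp add: t_def)
  have v: "v$1 = (\<rho> * cos \<phi> + 2 * z) / sqrt 5" "v$2 = (z - 2 * (\<rho> * cos \<phi>)) / sqrt 5" "v$3 = - (\<rho> * sin \<phi>)"
    by (simp_all add: v_def frame_vector \<rho>_def)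
  have "v$1 > v$2 \<longleftrightarrow> cos \<phi> > - (z / (3 * \<rho>))"
    using \<rho> unfolding v by (simp add: divide_less_cancel, simp add: field_simps, linarith)
  moreover have "v$2 > \<bar>v$3\<bar> \<longleftrightarrow> (2 * cos \<phi> + sqrt 5 * \<bar>sin \<phi>\<bar>) / 3 < z / (3 * \<rho>)"
    using \<rho> unfolding v by (simp add: abs_mult) (simp add: field_simps)
  ultimately show "v$1 > v$2 \<and> v$2 > \<bar>v$3\<bar> \<longleftrightarrow> \<phi> \<in> arc_set (t / (3 * sqrt (10 - t\<^sup>2)))"
    using \<phi> unfolding k arc_set_def by simp
  assume "v$1 > v$2" "v$2 > \<bar>v$3\<bar>"
  then have "oct_width v = sqrt 2 * (2 * v$1 + v$2)" by (rule oct_width_chamber)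
  also have "2 * v$1 + v$2 = 5 * z / sqrt 5"
    unfolding v by (simp flip: add_divide_distrib)
  also have "\<dots> = sqrt 5 * z" by (simp add: real_div_sqrt flip: times_divide_eq_left)
  also have "sqrt 2 * (sqrt 5 * z) = t" by (simp add: t_def flip: real_sqrt_mult mult.assoc)
  finally show "oct_width v = t" .
qed

context rotation_invariant_sphere
begin

text \<open>The height is uniform on an interval of length 2, hence the division.\<close>

lemma nn_integral_height:
  fixes F :: "real \<Rightarrow> ennreal"
  assumes [measurable]: "F \<in> borel_measurable borel"
  shows "(\<integral>\<^sup>+u. F (u$3) \<partial>N) = (\<integral>\<^sup>+z. F z * indicator {-1..1} z \<partial>lborel) / 2"
proof -
  have "(\<integral>\<^sup>+u. F (u$3) \<partial>N) = (\<integral>\<^sup>+u. F (u \<bullet> axis 3 1) \<partial>N)"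
    by (simp add: inner_axis)
  also have "\<dots> = (\<integral>\<^sup>+z. F z \<partial>distr N borel (\<lambda>u. u \<bullet> axis 3 1))"
    by (rule nn_integral_distr[symmetric]) simp_all
  also have "\<dots> = (\<integral>\<^sup>+z. F z \<partial>uniform_measure lborel {-1..1})"
    by (subst distr_inner_uniform) auto
  finally show ?thesis by (simp add: nn_integral_uniform_measure)
qed

text \<open>After rotation by the frame the width is constant on each horizontal slice of the
  chamber, so the azimuth integral is the value of \<open>F\<close> times an arc length.\<close>

lemma nn_integral_chamber_slices:
  fixes F :: "real \<Rightarrow> ennreal"
  assumes [measurable]: "F \<in> borel_measurable borel"
  shows "(\<integral>\<^sup>+u. F (oct_width u) * indicator {u. u$1 > u$2 \<and> u$2 > \<bar>u$3\<bar>} u \<partial>N)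
    = (\<integral>\<^sup>+u. F (sqrt 10 * u$3) * ennreal (sqrt 10 / 12 * trunc_oct_width_density (sqrt 10 * u$3)) \<partial>N)"
proof -
  let ?C = "{u::real^3. u$1 > u$2 \<and> u$2 > \<bar>u$3\<bar>}"
  let ?v = "\<lambda>u \<phi>. vector [sqrt (1 - (u$3)\<^sup>2) * cos \<phi>, sqrt (1 - (u$3)\<^sup>2) * sin \<phi>, u$3] :: real^3"
  define H where "H u = F (oct_width u) * indicator ?C u" for u
  have [measurable]: "?C \<in> sets borel" by measurable
  have [measurable]: "H \<in> borel_measurable borel" unfolding H_def by measurable
  have [measurable]: "(*v) octahedral_frame \<in> borel_measurable borel" by (rule measurable_matrix_vector_mult)
  have "(\<integral>\<^sup>+u. H u \<partial>N) = (\<integral>\<^sup>+u. H (octahedral_frame *v u) \<partial>N)"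
    by (rule nn_integral_rotation[symmetric, OF rotation_matrix_frame]) measurable
  also have "\<dots> = ennreal (1 / (2 * pi)) *
    (\<integral>\<^sup>+u. (\<integral>\<^sup>+\<phi>. H (octahedral_frame *v ?v u \<phi>) * indicator {-pi..<pi} \<phi> \<partial>lborel) \<partial>N)"
    by (rule nn_integral_azimuth) measurable
  also have "(\<integral>\<^sup>+u. (\<integral>\<^sup>+\<phi>. H (octahedral_frame *v ?v u \<phi>) * indicator {-pi..<pi} \<phi> \<partial>lborel) \<partial>N)
    = (\<integral>\<^sup>+u. ennreal (2 * pi) * (F (sqrt 10 * u$3) * ennreal (sqrt 10 / 12 * trunc_oct_width_density (sqrt 10 * u$3))) \<partial>N)"
  proof (rule nn_integral_cong_AE)
    \<comment> \<open>The poles are excluded because the slope divides by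
      \<open>sqrt (10 - t\<^sup>2)\<close>.\<close>
    have "AE u in N. \<bar>u$3\<bar> \<le> 1" "AE u in N. u$3 \<noteq> 1" "AE u in N. u$3 \<noteq> - 1"
      using AE_abs_inner_le[of "axis 3 1"] AE_inner_neq[of "axis 3 1"] by (auto simp: inner_axis)
    then show "AE u in N. (\<integral>\<^sup>+\<phi>. H (octahedral_frame *v ?v u \<phi>) * indicator {-pi..<pi} \<phi> \<partial>lborel)
      = ennreal (2 * pi) * (F (sqrt 10 * u$3) * ennreal (sqrt 10 / 12 * trunc_oct_width_density (sqrt 10 * u$3)))"
    proof eventually_elim
      case (elim u)
      then have z: "- 1 < u$3" "u$3 < 1" by auto
      define t where "t = sqrt 10 * u$3"
      have t: "- sqrt 10 < t" "t < sqrt 10" 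
        using z mult_strict_left_mono[of "- 1" "u$3" "sqrt 10"] mult_strict_left_mono[of "u$3" 1 "sqrt 10"]
        by (simp_all add: t_def)
      let ?A = "arc_set (t / (3 * sqrt (10 - t\<^sup>2)))"
      have A: "?A \<in> sets lborel" unfolding arc_set_def by measurable
      have "H (octahedral_frame *v ?v u \<phi>) * indicator {-pi..<pi} \<phi> = F t * indicator ?A \<phi>" for \<phi>
        using frame_oct_width[OF z, of \<phi>, folded t_def]
        by (auto simp: H_def arc_set_def split: split_indicator)
      then have "(\<integral>\<^sup>+\<phi>. H (octahedral_frame *v ?v u \<phi>) * indicator {-pi..<pi} \<phi> \<partial>lborel) = F t * emeasure lborel ?A"
        by (simp add: nn_integral_cmult_indicator[OF A])
      also have "emeasure lborel ?A = ennreal (2 * pi) * ennreal (sqrt 10 / 12 * trunc_oct_width_density t)"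
        unfolding emeasure_arc_set_density[OF t]
        by (simp add: trunc_oct_width_density_nonneg flip: ennreal_mult)
      finally show ?case by (simp add: t_def mult_ac)
    qed
  qed
  also have "\<dots> = ennreal (2 * pi) * (\<integral>\<^sup>+u. F (sqrt 10 * u$3) * ennreal (sqrt 10 / 12 * trunc_oct_width_density (sqrt 10 * u$3)) \<partial>N)"
    by (rule nn_integral_cmult) (simp cong: measurable_cong_sets)
  also have "ennreal (1 / (2 * pi)) * (ennreal (2 * pi) * x) = x" for x
    by (simp flip: ennreal_mult mult.assoc)
  finally show ?thesis by (simp add: H_def)
qed

text \<open>The substitution t = sqrt 10 z absorbs the factor \<open>sqrt 10\<close>. The constants
  cancel: 24 chambers, 1/12 from the slices and 1/2 from the height.\<close>

lemma distr_oct_width: "distr N borel oct_width = density lborel trunc_oct_width_density"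
proof (rule measure_eqI)
  fix B assume "B \<in> sets (distr N borel oct_width)"
  then have [measurable]: "B \<in> sets borel" by simp
  let ?f = "\<lambda>t. ennreal (trunc_oct_width_density t)"
  have "emeasure (distr N borel oct_width) B = (\<integral>\<^sup>+w. indicator B w \<partial>distr N borel oct_width)"
    by simp
  also have "\<dots> = (\<integral>\<^sup>+u. indicator B (oct_width u) \<partial>N)"
    by (rule nn_integral_distr) (simp_all cong: measurable_cong_sets)
  also have "\<dots> = 24 * (\<integral>\<^sup>+u. indicator B (sqrt 10 * u$3) * ennreal (sqrt 10 / 12 * trunc_oct_width_density (sqrt 10 * u$3)) \<partial>N)"
    by (subst nn_integral_chamber) (simp_all add: nn_integral_chamber_slices)
  also have "(\<integral>\<^sup>+u. indicator B (sqrt 10 * u$3) * ennreal (sqrt 10 / 12 * trunc_oct_width_density (sqrt 10 * u$3)) \<partial>N)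
    = (\<integral>\<^sup>+z. indicator B (sqrt 10 * z) * ennreal (sqrt 10 / 12 * trunc_oct_width_density (sqrt 10 * z)) * indicator {-1..1} z \<partial>lborel) / 2"
    by (rule nn_integral_height) simp
  \<comment> \<open>The summand 0 prepares the shape of the affine substitution rule. The
    restriction to [-1, 1] can go because the density vanishes outside.\<close>
  also have "(\<integral>\<^sup>+z. indicator B (sqrt 10 * z) * ennreal (sqrt 10 / 12 * trunc_oct_width_density (sqrt 10 * z)) * indicator {-1..1} z \<partial>lborel)
    = (\<integral>\<^sup>+z. ennreal (sqrt 10 / 12) * (?f (0 + sqrt 10 * z) * indicator B (0 + sqrt 10 * z)) \<partial>lborel)"
  proof (rule nn_integral_cong)
    fix z :: real
    have "trunc_oct_width_density (sqrt 10 * z) = 0" if "z \<notin> {-1..1}"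
    proof (rule trunc_oct_width_density_eq_0)
      consider "z > 1" | "z < - 1" using \<open>z \<notin> {-1..1}\<close> by fastforce
      then show "sqrt 10 * z < sqrt 6 \<or> sqrt 10 \<le> sqrt 10 * z"
      proof cases
        case 2
        then have "sqrt 10 * z < 0" by (intro mult_pos_neg) auto
        also have "0 < sqrt (6 :: real)" by simp
        finally show ?thesis ..
      qed simp
    qed
    then show "indicator B (sqrt 10 * z) * ennreal (sqrt 10 / 12 * trunc_oct_width_density (sqrt 10 * z)) * indicator {-1..1} z
      = ennreal (sqrt 10 / 12) * (?f (0 + sqrt 10 * z) * indicator B (0 + sqrt 10 * z))"
      by (auto simp: trunc_oct_width_density_nonneg split: split_indicator simp flip: ennreal_mult)
  qed
  also have "\<dots> = ennreal (1 / 12) * (ennreal \<bar>sqrt 10\<bar> * (\<integral>\<^sup>+z. ?f (0 + sqrt 10 * z) * indicator B (0 + sqrt 10 * z) \<partial>lborel))"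
    by (subst nn_integral_cmult) (simp_all flip: ennreal_mult mult.assoc)
  also have "ennreal \<bar>sqrt 10\<bar> * (\<integral>\<^sup>+z. ?f (0 + sqrt 10 * z) * indicator B (0 + sqrt 10 * z) \<partial>lborel)
    = (\<integral>\<^sup>+t. ?f t * indicator B t \<partial>lborel)"
    by (rule nn_integral_real_affine[symmetric]) simp_all
  also have "24 * (ennreal (1 / 12) * x / 2) = x" for x
  proof -
    have "24 * (ennreal (1 / 12) * x / 2) = (24 * ennreal (1 / 12)) * x / 2"
      by (simp add: ennreal_times_divide mult.assoc)
    also have "24 * ennreal (1 / 12) = ennreal 2"
      using ennreal_mult[of 24 "1 / 12"] by simp
    also have "ennreal 2 * x / 2 = x"
      by (simp add: ennreal_mult_divide_eq mult.commute)
    finally show ?thesis .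
  qed
  finally show "emeasure (distr N borel oct_width) B = emeasure (density lborel trunc_oct_width_density) B"
    by (simp add: emeasure_density)
qed simp

end

theorem theorem8p3:
  fixes M :: "'a measure" and U :: "'a \<Rightarrow> real^3" and W\<^sub>O :: "'a \<Rightarrow> real"
  assumes "prob_space M"
    and "U \<in> M \<rightarrow>\<^sub>M sphere_borel"
    and "uniform_on_sphere (distr M sphere_borel U)"
    and "W\<^sub>O = (\<lambda>\<omega>. width truncated_octahedron (U \<omega>))"
  shows "(AE \<omega> in M. W\<^sub>O \<omega> \<in> {sqrt 6..sqrt 10})
    \<and> topological_support (distr M borel W\<^sub>O) = {sqrt 6..sqrt 10}
    \<and> (\<forall>t. 0 \<le> trunc_oct_width_density t)
    \<and> distributed M lborel W\<^sub>O (\<lambda>t. ennreal (trunc_oct_width_density t))"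
proof -
  interpret M: prob_space M by fact
  have U [measurable]: "U \<in> borel_measurable M" and norm_U: "\<And>\<omega>. \<omega> \<in> space M \<Longrightarrow> norm (U \<omega>) = 1"
    using assms(2) by (auto simp: measurable_restrict_space2_iff)
  define N where "N = distr M borel U"
  have W: "W\<^sub>O = (\<lambda>\<omega>. oct_width (U \<omega>))"
    using assms(4) by (simp add: width_truncated_octahedron)
  have [measurable]: "W\<^sub>O \<in> borel_measurable M" unfolding W by measurable
  let ?\<nu> = "distr M sphere_borel U"
  interpret N: rotation_invariant_sphere N
  proof (intro rotation_invariant_sphere.intro rotation_invariant_sphere_axioms.intro)
    show "prob_space N" unfolding N_def by (rule M.prob_space_distr) simp
    show "sets N = sets borel" by (simp add: N_def)
    show "AE u in N. norm u = 1"
      unfolding N_def by (subst AE_distr_iff) (auto intro!: AE_I2 norm_U)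
    fix Q :: "real^3^3" assume Q: "rotation_matrix Q"
    then have oT: "orthogonal_transformation ((*v) Q)"
      by (simp add: rotation_matrix_def orthogonal_transformation_matrix matrix_of_matrix_vector_mul)
    then have n: "norm (Q *v x) = norm x" for x
      by (auto simp: orthogonal_transformation)
    have Qb [measurable]: "(*v) Q \<in> borel_measurable borel"
      by (rule measurable_matrix_vector_mult)
    have Qs: "(*v) Q \<in> sphere_borel \<rightarrow>\<^sub>M sphere_borel"
      using Qb by (intro measurable_restrict_space3) (auto simp: n)
    have id: "(\<lambda>x. x) \<in> sphere_borel \<rightarrow>\<^sub>M borel" by (rule measurable_restrict_space1) simp
    have inv: "distr ?\<nu> ?\<nu> ((*v) Q) = ?\<nu>"
      using assms(3) Q by (simp add: uniform_on_sphere_def)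
    \<comment> \<open>\<open>N\<close> is the image of the law on the sphere under the inclusion,
      through which rotation invariance is transported.\<close>
    have N: "N = distr ?\<nu> borel (\<lambda>x. x)"
      unfolding N_def by (subst distr_distr[OF id assms(2)]) (simp add: comp_def)
    have "distr N borel ((*v) Q) = distr ?\<nu> borel ((*v) Q)"
      unfolding N using id by (subst distr_distr) (auto simp: comp_def)
    also have "\<dots> = distr (distr ?\<nu> ?\<nu> ((*v) Q)) borel (\<lambda>x. x)"
      using id Qs by (subst distr_distr) (auto simp: comp_def)
    finally show "distr N borel ((*v) Q) = N" unfolding inv N .
  qed
  have dens: "distr M borel W\<^sub>O = density lborel trunc_oct_width_density"
    unfolding N.distr_oct_width[symmetric] N_def W by (simp add: distr_distr comp_def)
  have "distr M lborel W\<^sub>O = distr M borel W\<^sub>O" by (rule distr_cong) simp_all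
  then have dist: "distributed M lborel W\<^sub>O (\<lambda>t. ennreal (trunc_oct_width_density t))"
    unfolding distributed_def by (simp add: dens)
  have "sqrt 6 \<le> t \<and> t \<le> sqrt 10" if "0 < trunc_oct_width_density t" for t
    using that trunc_oct_width_density_eq_0[of t] by fastforce
  then have "AE t in density lborel trunc_oct_width_density. t \<in> {sqrt 6..sqrt 10}"
    by (subst AE_density) (auto intro!: AE_I2)
  then have AE: "AE \<omega> in M. W\<^sub>O \<omega> \<in> {sqrt 6..sqrt 10}"
    unfolding dens[symmetric] by (subst (asm) AE_distr_iff) auto
  have "topological_support (distr M borel W\<^sub>O) = {sqrt 6..sqrt 10}"
  proof (intro equalityI subsetI)
    fix x assume x: "x \<in> topological_support (distr M borel W\<^sub>O)"
    show "x \<in> {sqrt 6..sqrt 10}"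
    proof (rule ccontr)
      \<comment> \<open>The complement of the closed interval is then an open neighbourhood of
        \<open>x\<close> of measure zero.\<close>
      assume "x \<notin> {sqrt 6..sqrt 10}"
      then have "emeasure (distr M borel W\<^sub>O) (- {sqrt 6..sqrt 10}) > 0"
        using x by (auto simp: topological_support_def open_Compl)
      moreover have "emeasure (distr M borel W\<^sub>O) (- {sqrt 6..sqrt 10}) = 0"
      proof -
        have "W\<^sub>O -` (- {sqrt 6..sqrt 10}) \<inter> space M = {\<omega> \<in> space M. W\<^sub>O \<omega> \<notin> {sqrt 6..sqrt 10}}" by auto
        moreover have "emeasure M \<dots> = 0" using AE by (intro emeasure_eq_0_AE) simp
        ultimately show ?thesis by (simp add: emeasure_distr)
      qed
      ultimately show False by simp
    qed
  next
    fix x assume x: "x \<in> {sqrt 6..sqrt 10}"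
    have "emeasure (distr M borel W\<^sub>O) V > 0" if V: "open V" "x \<in> V" for V
    proof (rule ccontr)
      assume "\<not> emeasure (distr M borel W\<^sub>O) V > 0"
      then have "emeasure (density lborel trunc_oct_width_density) V = 0" by (simp add: dens)
      \<comment> \<open>A neighbourhood of measure zero would meet the open interval in a null set,
        since the density is positive there; yet this intersection is open and nonempty.\<close>
      then have "AE t in lborel. t \<in> V \<longrightarrow> trunc_oct_width_density t \<le> 0"
        using V by (simp add: emeasure_density nn_integral_0_iff_AE) (auto elim!: eventually_mono split: split_indicator_asm simp: ennreal_eq_0_iff)
      then have "AE t in lborel. t \<notin> V \<inter> {sqrt 6<..<sqrt 10}"
        by eventually_elim (use trunc_oct_width_density_pos in force)
      then have "V \<inter> {sqrt 6<..<sqrt 10} \<in> null_sets lborel"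
        using V by (subst AE_iff_null_sets) auto
      then have "negligible (V \<inter> {sqrt 6<..<sqrt 10})"
        by (simp add: negligible_iff_null_sets null_sets_completionI)
      moreover have "open (V \<inter> {sqrt 6<..<sqrt 10})" using V by auto
      moreover have "V \<inter> {sqrt 6<..<sqrt 10} \<noteq> {}"
      proof -
        \<comment> \<open>\<open>x\<close> may be an endpoint, hence the closure.\<close>
        have "x \<in> closure {sqrt 6<..<sqrt 10}" using x by simp
        then show ?thesis using V by (metis open_Int_closure_eq_empty disjoint_iff inf_commute)
      qed
      ultimately show False using open_not_negligible by blast
    qed
    then show "x \<in> topological_support (distr M borel W\<^sub>O)"
      by (auto simp: topological_support_def)
  qed
  with AE dist show ?thesis by (simp add: trunc_oct_width_density_nonneg)
qed

end
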